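(* Fix $t\in I$ and assume that there are bilinear forms $\dot A_t:V\times V\to\mathbb R$, $\dot B_t:X\times X\to\mathbb R$ with $$|\dot A_t(u,v)|\le C\|u\|_V\|v\|_V\ (u,v\in V),\qquad|\dot B_t(u,v)|\le C|u|_X|v|_X\ (u,v\in X),$$ $$\lim_{h\to0}\frac1h\sup_{\|u\|_V,\|v\|_V\le1}\bigl|(A_{t+h}-A_t-h\dot A_t)(u,v)\bigr|=0,\qquad\lim_{h\to0}\frac1h\sup_{|u|_X,|v|_X\le1}\bigl|(B_{t+h}-B_t-h\dot B_t)(u,v)\bigr|=0.$$ Let $k,m\ge1$ be integers such that $\lambda_{k-1}(t)<\lambda_k(t)=\cdots=\lambda_{k+m-1}(t)<\lambda_{k+m}(t)$, put $\lambda=\lambda_k(t)$, and let $Y_t^\lambda=\{u\in V\mid A_t(u,v)=\lambda B_t(u,v)\ \forall v\in V\}$ be the $m$-dimensional eigenspace. Then the unilateral limits $$\dot\lambda_j^\pm(t)=\lim_{h\to\pm0}\frac1h\{\lambda_j(t+h)-\lambda_j(t)\},\qquad k\le j\le k+m-1,$$ exist, and $$\dot\lambda_j^+(t)=\mu_{j-k+1},\qquad\dot\lambda_j^-(t)=\mu_{k+m-j},\qquad k\le j\le k+m-1,$$ where $\mu_q$, $1\le q\le m$, is the $q$-th eigenvalue (nondecreasing order, with multiplicity) of the finite-dimensional problem $$u\in Y_t^\lambda,\qquad E_t^\lambda(u,v)=\mu B_t(u,v),\ \forall v\in Y_t^\lambda,\qquad E_t^\lambda=\dot A_t-\lambda\dot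 B_t.$$ In particular $\dot\lambda_j^+(t)=\dot\lambda^-_{2k+m-1-j}(t)$ for $k\le j\le k+m-1$.
   Context: Abstract setting. $X$ (norm $|\cdot|_X$) and $V$ (norm $\|\cdot\|_V$) are real Hilbert spaces with compact embedding $V\hookrightarrow X$; $I=(-\varepsilon_0,\varepsilon_0)$, $\varepsilon_0>0$. For $t\in I$, $A_t:V\times V\to\mathbb R$ and $B_t:X\times X\to\mathbb R$ are symmetric bilinear forms such that, with constants $C,\delta>0$ independent of $t$, $$|A_t(u,v)|\le C\|u\|_V\|v\|_V,\quad A_t(u,u)\ge\delta\|u\|_V^2\quad(u,v\in V),$$ $$|B_t(u,v)|\le C|u|_X|v|_X,\quad B_t(u,u)\ge\delta|u|_X^2\quad(u,v\in X).$$ The eigenvalue problem is: $u\in V$, $B_t(u,u)=1$, $A_t(u,v)=\lambda B_t(u,v)$ for all $v\in V$. Its eigenvalues, listed with multiplicity, form an infinite sequence $0<\lambda_1(t)\le\lambda_2(t)\le\cdots\to+\infty$, given by $\lambda_j(t)=\min_{L_j}\max_{v\in L_j\setminus\{0\}}A_t(v,v)/B_t(v,v)$ over subspaces $L_j\subset V$ of dimension $j$. Convention: $\lambda_0(t)=-\infty$. *)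

theory Defs
  imports "HOL-Analysis.Analysis"
begin

definition compact_embedding :: "('v::real_normed_vector \<Rightarrow> 'x::real_normed_vector) \<Rightarrow> bool" where
  "compact_embedding \<iota> \<longleftrightarrow>
     bounded_linear \<iota> \<and> inj \<iota> \<and> (\<forall>S. bounded S \<longrightarrow> compact (closure (\<iota> ` S)))"

definition form_sup :: "('a::real_normed_vector \<Rightarrow> 'a \<Rightarrow> real) \<Rightarrow> real" where
  "form_sup f = (SUP (u, v) \<in> cball 0 1 \<times> cball 0 1. \<bar>f u v\<bar>)"

text \<open>The problem \<open>u \<in> S\<close>, \<open>a u v = \<mu> * b u v\<close> for all \<open>v \<in> S\<close>.\<close>

definition eigenspace ::
    "'a::real_vector set \<Rightarrow> ('a \<Rightarrow> 'a \<Rightarrow> real) \<Rightarrow> ('a \<Rightarrow> 'a \<Rightarrow> real) \<Rightarrow> real \<Rightarrow> 'a set" where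
  "eigenspace S a b \<mu> = {u \<in> S. \<forall>v\<in>S. a u v = \<mu> * b u v}"

text \<open>The form \<open>b\<close> is always positive definite below, so the normalization \<open>b u u = 1\<close> amounts to
  \<open>u \<noteq> 0\<close>.\<close>

definition eigenvalue ::
    "'a::real_vector set \<Rightarrow> ('a \<Rightarrow> 'a \<Rightarrow> real) \<Rightarrow> ('a \<Rightarrow> 'a \<Rightarrow> real) \<Rightarrow> real \<Rightarrow> bool" where
  "eigenvalue S a b \<mu> \<longleftrightarrow> (\<exists>u \<in> eigenspace S a b \<mu>. b u u = 1)"

definition eigenvalue_count ::
    "'a::real_vector set \<Rightarrow> ('a \<Rightarrow> 'a \<Rightarrow> real) \<Rightarrow> ('a \<Rightarrow> 'a \<Rightarrow> real) \<Rightarrow> real \<Rightarrow> nat" where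
  "eigenvalue_count S a b \<mu> =
     (\<Sum>\<nu> | eigenvalue S a b \<nu> \<and> \<nu> \<le> \<mu>. dim (eigenspace S a b \<nu>))"

text \<open>The \<open>j\<close>-th eigenvalue, \<open>j \<ge> 1\<close>, in nondecreasing order and counted with multiplicity; the
  following lemma shows that any such listing of all eigenvalues, finite or infinite, is given by
  this function.\<close>

definition nth_eigenvalue ::
    "'a::real_vector set \<Rightarrow> ('a \<Rightarrow> 'a \<Rightarrow> real) \<Rightarrow> ('a \<Rightarrow> 'a \<Rightarrow> real) \<Rightarrow> nat \<Rightarrow> real" where
  "nth_eigenvalue S a b j = (LEAST \<mu>. j \<le> eigenvalue_count S a b \<mu>)"

lemma nth_eigenvalue_listing:
  fixes l :: "nat \<Rightarrow> real"
  assumes J: "J = {1..} \<or> J = {1..n}"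
    and mono: "mono_on J l"
    and fin: "\<And>\<mu>. finite {j \<in> J. l j \<le> \<mu>}"
    and img: "l ` J = {\<mu>. eigenvalue S a b \<mu>}"
    and mult: "\<And>\<mu>. eigenvalue S a b \<mu> \<Longrightarrow> card {j \<in> J. l j = \<mu>} = dim (eigenspace S a b \<mu>)"
    and j: "j \<in> J"
  shows "nth_eigenvalue S a b j = l j"
proof -
  have count: "eigenvalue_count S a b \<mu> = card {i \<in> J. l i \<le> \<mu>}" for \<mu>
  proof -
    let ?F = "{i \<in> J. l i \<le> \<mu>}"
    have E: "{\<nu>. eigenvalue S a b \<nu> \<and> \<nu> \<le> \<mu>} = l ` ?F"
      using img by auto
    have "card ?F = (\<Sum>\<nu> \<in> l ` ?F. card {i \<in> ?F. l i = \<nu>})"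
      using sum.image_gen[OF fin[of \<mu>], of "\<lambda>_. 1::nat" l] by simp
    also have "\<dots> = (\<Sum>\<nu> \<in> l ` ?F. dim (eigenspace S a b \<nu>))"
    proof (rule sum.cong[OF refl])
      fix \<nu> assume "\<nu> \<in> l ` ?F"
      then have "eigenvalue S a b \<nu>" "{i \<in> ?F. l i = \<nu>} = {i \<in> J. l i = \<nu>}"
        using img by auto
      then show "card {i \<in> ?F. l i = \<nu>} = dim (eigenspace S a b \<nu>)"
        using mult by simp
    qed
    finally show ?thesis
      unfolding eigenvalue_count_def E by simp
  qed
  have "j \<le> card {i \<in> J. l i \<le> l j}"
  proof -
    have "{1..j} \<subseteq> {i \<in> J. l i \<le> l j}"
      using J j mono by (auto simp: mono_on_def)
    from card_mono[OF fin this] show ?thesis by simp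
  qed
  moreover have "l j \<le> \<mu>" if "j \<le> card {i \<in> J. l i \<le> \<mu>}" for \<mu>
  proof (rule ccontr)
    assume less: "\<not> l j \<le> \<mu>"
    have "{i \<in> J. l i \<le> \<mu>} \<subseteq> {1..<j}"
    proof
      fix i assume i: "i \<in> {i \<in> J. l i \<le> \<mu>}"
      have "i < j"
      proof (rule ccontr)
        assume "\<not> i < j"
        then have "l j \<le> l i"
          using i j mono by (auto simp: mono_on_def)
        then show False
          using i less by simp
      qed
      then show "i \<in> {1..<j}"
        using i J by auto
    qed
    from card_mono[OF _ this] have "card {i \<in> J. l i \<le> \<mu>} \<le> j - 1" by simp
    moreover have "1 \<le> j" using j J by auto
    ultimately show False using that by simp
  qed
  ultimately show ?thesis
    unfolding nth_eigenvalue_def count by (intro Least_equality) auto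
qed

end

theory Submission
  imports Defs
begin

text \<open>
  The eigenvalues of a perturbed pair of forms are compared with those of the unperturbed pair
  through the min-max principle alone; no eigenvector is followed along the perturbation. Write
  \<open>a\<close>, \<open>b\<close> for the forms at the fixed parameter (with \<open>b\<close> pulled back along the compact embedding),
  \<open>a\<^sub>h\<close>, \<open>b\<^sub>h\<close> for the forms at distance \<open>h\<close>, \<open>\<kappa>\<close> for the \<open>m\<close>-fold eigenvalue with numbers
  \<open>k, \<dots>, k + m - 1\<close>, \<open>Y\<close> for its eigenspace, and \<open>E = a' - \<kappa> * b'\<close>. Then

    \<open>a\<^sub>h - (\<kappa> + h * \<nu>) * b\<^sub>h = (a - \<kappa> * b) + h * (E - \<nu> * b) + o(h)\<close>.

  The first term vanishes on \<open>Y\<close>, is uniformly negative on the span of the lower eigenvectors and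
  uniformly positive on the \<open>b\<close>-orthogonal complement of all eigenvectors with numbers below
  \<open>k + m\<close>; there it dominates everything of size \<open>h\<close>. On \<open>Y\<close> the second term decides, and the
  cross terms, of size \<open>h\<close> in a product of both components, are absorbed jointly. Choose a \<open>b\<close>-orthonormal basis \<open>y\<^sub>1, \<dots>, y\<^sub>m\<close> of \<open>Y\<close> diagonalizing \<open>E\<close> with values
  \<open>\<mu>\<^sub>1 \<le> \<dots> \<le> \<mu>\<^sub>m\<close>. For \<open>\<nu> = \<mu>\<^sub>q + \<epsilon>\<close> and small \<open>h > 0\<close> the sum is nonpositive on the span of the
  lower eigenvectors and \<open>y\<^sub>1, \<dots>, y\<^sub>q\<close>, a space of dimension \<open>k + q - 1\<close>; for \<open>\<nu> = \<mu>\<^sub>q - \<epsilon>\<close> it is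
  nonnegative on the orthogonal complement of the lower eigenvectors and \<open>y\<^sub>1, \<dots>, y\<^bsub>q-1\<^esub>\<close>, a space
  of codimension \<open>k + q - 2\<close>. The two halves of the Courant-Fischer principle
  (\<open>ev_le_if_subspace\<close>, \<open>ev_ge_if_orthogonal\<close>) for \<open>(a\<^sub>h, b\<^sub>h)\<close> then enclose the eigenvalue with
  number \<open>k + q - 1\<close> between \<open>\<kappa> + h * (\<mu>\<^sub>q - \<epsilon>)\<close> and \<open>\<kappa> + h * (\<mu>\<^sub>q + \<epsilon>)\<close>; this is
  \<open>eigenvalue_right_derivative\<close>, and its analytic core is \<open>perturbed_form_nonneg\<close>. Reversing the
  parameter replaces \<open>E\<close> by \<open>- E\<close>, hence the ordered values \<open>\<mu>\<^sub>q\<close> by \<open>- \<mu>\<^bsub>m+1-q\<^esub>\<close>, which gives the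
  derivatives from the left.

  The spectral theory comes from minimizing the Rayleigh quotient on closed subspaces
  (\<open>rayleigh_minimizer\<close>, \<open>eigenbasis_exists\<close>); the same construction produces the eigenvectors of
  the infinite-dimensional problem and the basis of \<open>Y\<close> that diagonalizes \<open>E\<close>.
\<close>

section \<open>Inner products given by a bounded form\<close>

text \<open>The norm defined by \<open>b\<close> may be strictly weaker than the norm of the space, so
  the space need not be complete for it, and projections onto infinite-dimensional closed subspaces
  may fail to exist; this is why all projections go onto finite orthonormal families.\<close>

locale inner_form =
  fixes b :: "'v::real_normed_vector \<Rightarrow> 'v \<Rightarrow> real"
  assumes bounded: "bounded_bilinear b"
    and sym: "b u v = b v u"
    and pos: "u \<noteq> 0 \<Longrightarrow> 0 < b u u"
begin

sublocale b: bounded_bilinear b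
  by (rule bounded)

lemma eq_0_iff: "b u u = 0 \<longleftrightarrow> u = 0"
  using pos[of u] b.zero_left by force

lemma nonneg: "0 \<le> b u u"
  using pos[of u] b.zero_left by (cases "u = 0") auto

lemma orthogonal_to_span:
  assumes "\<And>g. g \<in> G \<Longrightarrow> b u g = 0" and "v \<in> span G"
  shows "b u v = 0"
  using assms(2)
  by (induction rule: span_induct_alt) (simp_all add: b.zero_right b.add_right b.scaleR_right assms(1))

definition orthonormal :: "'i set \<Rightarrow> ('i \<Rightarrow> 'v) \<Rightarrow> bool" where
  "orthonormal I f \<longleftrightarrow> (\<forall>i\<in>I. \<forall>j\<in>I. b (f i) (f j) = of_bool (i = j))"

lemma orthonormalD: "orthonormal I f \<Longrightarrow> i \<in> I \<Longrightarrow> j \<in> I \<Longrightarrow> b (f i) (f j) = of_bool (i = j)"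
  by (simp add: orthonormal_def)

lemma orthonormal_subset: "orthonormal J f \<Longrightarrow> I \<subseteq> J \<Longrightarrow> orthonormal I f"
  unfolding orthonormal_def by blast

lemma orthonormal_inj_on:
  assumes "orthonormal I f"
  shows "inj_on f I"
proof (rule inj_onI)
  fix i j assume "i \<in> I" "j \<in> I" "f i = f j"
  then show "i = j"
    using orthonormalD[OF assms, of i i] orthonormalD[OF assms, of i j] by (cases "i = j") auto
qed

lemma orthonormal_independent:
  assumes "orthonormal I f"
  shows "independent (f ` I)"
proof
  assume "dependent (f ` I)"
  then obtain i where i: "i \<in> I" "f i \<in> span (f ` I - {f i})"
    by (auto simp: dependent_def)
  have "b (f i) (f i) = 0"
  proof (rule orthogonal_to_span[OF _ i(2)])
    fix g assume "g \<in> f ` I - {f i}"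
    then show "b (f i) g = 0"
      using orthonormalD[OF assms i(1)] by auto
  qed
  then show False
    using orthonormalD[OF assms i(1) i(1)] by simp
qed

lemma projection_remainder_orthogonal:
  assumes "orthonormal I f" "finite I" "j \<in> I"
  shows "b (v - (\<Sum>i\<in>I. b v (f i) *\<^sub>R f i)) (f j) = 0"
proof -
  have "(\<Sum>i\<in>I. b v (f i) * b (f i) (f j)) = (\<Sum>i\<in>I. if i = j then b v (f i) else 0)"
    using assms by (intro sum.cong) (auto simp: orthonormalD)
  then show ?thesis
    using assms by (simp add: b.diff_left b.sum_left b.scaleR_left)
qed

lemma orthonormal_expansion:
  assumes "orthonormal I f" "finite I" "v \<in> span (f ` I)"
  shows "v = (\<Sum>i\<in>I. b v (f i) *\<^sub>R f i)"
proof -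
  let ?r = "v - (\<Sum>i\<in>I. b v (f i) *\<^sub>R f i)"
  have "?r \<in> span (f ` I)"
    by (intro span_diff assms(3) span_sum span_scale span_base) auto
  then have "b ?r ?r = 0"
    by (rule orthogonal_to_span[rotated]) (auto simp: projection_remainder_orthogonal[OF assms(1,2)])
  then show ?thesis by (simp add: eq_0_iff)
qed

lemma diagonal_form:
  assumes on: "orthonormal I f" and fin: "finite I" and v: "v \<in> span (f ` I)"
    and E: "bounded_bilinear E"
    and diag: "\<And>i j. i \<in> I \<Longrightarrow> j \<in> I \<Longrightarrow> E (f i) (f j) = \<mu> i * b (f i) (f j)"
  shows "E v v = (\<Sum>i\<in>I. \<mu> i * (b v (f i))\<^sup>2)"
proof -
  interpret E: bounded_bilinear E by (rule E)
  define c where "c i = b v (f i)" for i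
  have v': "v = (\<Sum>i\<in>I. c i *\<^sub>R f i)"
    unfolding c_def by (rule orthonormal_expansion[OF on fin v])
  have "E v v = (\<Sum>i\<in>I. \<Sum>j\<in>I. c i * (c j * E (f i) (f j)))"
    unfolding v' E.sum_left E.sum_right E.scaleR_left E.scaleR_right
    by (simp add: sum_distrib_left, subst sum.swap) (simp add: mult.left_commute)
  also have "\<dots> = (\<Sum>i\<in>I. \<Sum>j\<in>I. if j = i then \<mu> i * (c i)\<^sup>2 else 0)"
    using on by (intro sum.cong refl) (auto simp: diag orthonormalD power2_eq_square)
  also have "\<dots> = (\<Sum>i\<in>I. \<mu> i * (c i)\<^sup>2)"
    using fin by simp
  finally show ?thesis by (simp add: c_def)
qed

lemma parseval:
  assumes "orthonormal I f" "finite I" "v \<in> span (f ` I)"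
  shows "b v v = (\<Sum>i\<in>I. (b v (f i))\<^sup>2)"
  using diagonal_form[OF assms bounded, of "\<lambda>_. 1"] by simp

text \<open>Bounds on the diagonal entries bound the whole quadratic form relative to \<open>b\<close>; this is how values
  on eigenvectors become inequalities on the subspaces entering the min-max principle.\<close>

lemma diagonal_form_le:
  assumes "orthonormal I f" "finite I" "v \<in> span (f ` I)" "bounded_bilinear E"
    and "\<And>i j. i \<in> I \<Longrightarrow> j \<in> I \<Longrightarrow> E (f i) (f j) = \<mu> i * b (f i) (f j)"
    and "\<And>i. i \<in> I \<Longrightarrow> \<mu> i \<le> c"
  shows "E v v \<le> c * b v v"
  using diagonal_form[OF assms(1-4), of \<mu>] assms(5,6)
  by (auto simp: parseval[OF assms(1-3)] sum_distrib_left intro!: sum_mono mult_right_mono)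

lemma diagonal_form_ge:
  assumes "orthonormal I f" "finite I" "v \<in> span (f ` I)" "bounded_bilinear E"
    and "\<And>i j. i \<in> I \<Longrightarrow> j \<in> I \<Longrightarrow> E (f i) (f j) = \<mu> i * b (f i) (f j)"
    and "\<And>i. i \<in> I \<Longrightarrow> c \<le> \<mu> i"
  shows "c * b v v \<le> E v v"
  using diagonal_form[OF assms(1-4), of \<mu>] assms(5,6)
  by (auto simp: parseval[OF assms(1-3)] sum_distrib_left intro!: sum_mono mult_right_mono)

text \<open>The map \<open>v \<mapsto> \<Sum>g\<in>G. b v g *\<^sub>R g\<close> sends \<open>span F\<close> into \<open>span G\<close>, so it cannot be injective there;
  a vector in its kernel is orthogonal to \<open>G\<close>, because \<open>b v (\<Sum>g\<in>G. b v g *\<^sub>R g)\<close> is a sum of squares.\<close>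

lemma exists_orthogonal_in_span:
  assumes "finite G" "independent F" "card G < card F"
  obtains v where "v \<in> span F" "v \<noteq> 0" "\<And>g. g \<in> G \<Longrightarrow> b v g = 0"
proof -
  define P where "P v = (\<Sum>g\<in>G. b v g *\<^sub>R g)" for v
  have P: "linear P"
    unfolding P_def
    by (intro linearI)
      (simp_all add: b.add_left b.scaleR_left scaleR_add_left sum.distrib scaleR_sum_right)
  have "\<not> inj_on P (span F)"
  proof
    assume "inj_on P (span F)"
    then have "independent (P ` F)" "card (P ` F) = card F"
      using linear_independent_injective_image[OF P assms(2)]
      by (auto intro!: card_image intro: inj_on_subset[OF _ span_superset])
    moreover have "P ` F \<subseteq> span G"
      unfolding P_def by (intro image_subsetI span_sum span_scale span_base)
    ultimately show False
      using independent_span_bound[OF assms(1), of "P ` F"] assms(3) by simp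
  qed
  then obtain v where v: "v \<in> span F" "v \<noteq> 0" "P v = 0"
    using linear_injective_on_subspace_0[OF P subspace_span] by blast
  have "(\<Sum>g\<in>G. (b v g)\<^sup>2) = b v (P v)"
    by (simp add: P_def b.sum_right b.scaleR_right power2_eq_square)
  also have "\<dots> = 0"
    by (simp add: v b.zero_right)
  finally have "\<And>g. g \<in> G \<Longrightarrow> b v g = 0"
    using assms(1) by (simp add: sum_nonneg_eq_0_iff)
  with v that show ?thesis by blast
qed

lemma normalize:
  assumes "bounded_bilinear E" "v \<noteq> 0"
  defines "u \<equiv> (1 / sqrt (b v v)) *\<^sub>R v"
  shows "b u u = 1" and "E u u = E v v / b v v"
proof -
  interpret E: bounded_bilinear E by (rule assms(1))
  have "sqrt (b v v) * sqrt (b v v) = b v v" "b v v \<noteq> 0"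
    using pos[OF assms(2)] by auto
  then show "b u u = 1" "E u u = E v v / b v v"
    by (simp_all add: u_def b.scaleR_left b.scaleR_right E.scaleR_left E.scaleR_right)
qed

section \<open>Orthonormal eigenvectors and numbered eigenvalues\<close>

lemma subspace_eigenspace:
  assumes "subspace S" "bounded_bilinear E"
  shows "subspace (eigenspace S E b \<mu>)"
proof -
  interpret E: bounded_bilinear E by (rule assms(2))
  show ?thesis
    using assms(1)
    by (auto simp: subspace_def eigenspace_def b.zero_left E.zero_left b.add_left E.add_left
        b.scaleR_left E.scaleR_left algebra_simps)
qed

text \<open>Completeness is assumed in the weak form that no eigenvector is orthogonal to the whole family. It
  suffices, since eigenvectors to distinct eigenvalues are orthogonal: what remains of an eigenvector
  after projection to the members with its own eigenvalue is orthogonal to the entire family.\<close>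

lemma eigenspace_eq_span:
  assumes S: "subspace S"
    and E: "bounded_bilinear E" "\<And>u v. u \<in> S \<Longrightarrow> v \<in> S \<Longrightarrow> E u v = E v u"
    and inS: "\<And>j. j \<in> J \<Longrightarrow> e j \<in> S" and on: "orthonormal J e"
    and eig: "\<And>j v. j \<in> J \<Longrightarrow> v \<in> S \<Longrightarrow> E (e j) v = l j * b (e j) v"
    and complete: "\<And>u. u \<in> eigenspace S E b \<mu> \<Longrightarrow> (\<And>j. j \<in> J \<Longrightarrow> b u (e j) = 0) \<Longrightarrow> u = 0"
    and fin: "finite {j \<in> J. l j = \<mu>}"
  shows "eigenspace S E b \<mu> = span (e ` {j \<in> J. l j = \<mu>})"
proof
  let ?I = "{j \<in> J. l j = \<mu>}"
  note sub = subspace_eigenspace[OF S E(1), of \<mu>]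
  have e: "e j \<in> eigenspace S E b \<mu>" if "j \<in> ?I" for j
    using that inS eig by (auto simp: eigenspace_def)
  then show "span (e ` ?I) \<subseteq> eigenspace S E b \<mu>"
    by (intro span_minimal sub) auto
  show "eigenspace S E b \<mu> \<subseteq> span (e ` ?I)"
  proof
    fix u assume u: "u \<in> eigenspace S E b \<mu>"
    define p where "p = (\<Sum>i\<in>?I. b u (e i) *\<^sub>R e i)"
    have r: "u - p \<in> eigenspace S E b \<mu>"
      unfolding p_def by (intro subspace_diff sub u subspace_sum subspace_scale e)
    have "u - p = 0"
    proof (rule complete[OF r])
      fix j assume j: "j \<in> J"
      show "b (u - p) (e j) = 0"
      proof (cases "l j = \<mu>")
        case True
        then show ?thesis
          unfolding p_def using j orthonormal_subset[OF on, of ?I]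
          by (intro projection_remainder_orthogonal fin) auto
      next
        case False
        have "E (u - p) (e j) = \<mu> * b (u - p) (e j)" "u - p \<in> S"
          using r inS[OF j] by (auto simp: eigenspace_def)
        then have "(l j - \<mu>) * b (u - p) (e j) = 0"
          using eig[OF j, of "u - p"] E(2)[of "u - p" "e j"] inS[OF j] sym[of "e j" "u - p"]
          by (simp add: algebra_simps)
        then show ?thesis using False by simp
      qed
    qed
    then have "u = p" by simp
    then show "u \<in> span (e ` ?I)"
      unfolding p_def by (metis (no_types, lifting) span_sum span_scale span_base imageI)
  qed
qed

text \<open>The two shapes of \<open>J\<close> cover the spectrum on an infinite-dimensional space and the finite-dimensional
  problem on an eigenspace.\<close>

lemma nth_eigenvalue_eq:
  assumes J: "J = {1..} \<or> J = {1..n}"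
    and S: "subspace S"
    and E: "bounded_bilinear E" "\<And>u v. u \<in> S \<Longrightarrow> v \<in> S \<Longrightarrow> E u v = E v u"
    and inS: "\<And>j. j \<in> J \<Longrightarrow> e j \<in> S" and on: "orthonormal J e"
    and eig: "\<And>j v. j \<in> J \<Longrightarrow> v \<in> S \<Longrightarrow> E (e j) v = l j * b (e j) v"
    and complete: "\<And>\<mu> u. u \<in> eigenspace S E b \<mu> \<Longrightarrow> (\<And>j. j \<in> J \<Longrightarrow> b u (e j) = 0) \<Longrightarrow> u = 0"
    and fin: "\<And>\<mu>. finite {j \<in> J. l j \<le> \<mu>}" and mono: "mono_on J l" and j: "j \<in> J"
  shows "nth_eigenvalue S E b j = l j"
proof (rule nth_eigenvalue_listing[OF J mono fin _ _ j])
  have fin': "finite {j \<in> J. l j = \<mu>}" for \<mu>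
    by (rule finite_subset[OF _ fin[of \<mu>]]) auto
  have span: "eigenspace S E b \<mu> = span (e ` {j \<in> J. l j = \<mu>})" for \<mu>
    using eig by (intro eigenspace_eq_span S E inS on complete fin') auto
  show "l ` J = {\<mu>. eigenvalue S E b \<mu>}"
  proof (intro subset_antisym subsetI)
    fix \<mu> assume "\<mu> \<in> l ` J"
    then obtain i where i: "i \<in> J" "l i = \<mu>" by auto
    have "e i \<in> eigenspace S E b \<mu>"
      using i inS eig by (auto simp: eigenspace_def)
    moreover have "b (e i) (e i) = 1"
      using orthonormalD[OF on i(1) i(1)] by simp
    ultimately show "\<mu> \<in> {\<mu>. eigenvalue S E b \<mu>}"
      by (auto simp: eigenvalue_def)
  next
    fix \<mu> assume "\<mu> \<in> {\<mu>. eigenvalue S E b \<mu>}"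
    then obtain u where u: "u \<in> eigenspace S E b \<mu>" "b u u = 1"
      by (auto simp: eigenvalue_def)
    have "u \<noteq> 0" using u(2) b.zero_left by force
    show "\<mu> \<in> l ` J"
    proof (rule ccontr)
      assume "\<mu> \<notin> l ` J"
      then have empty: "{j \<in> J. l j = \<mu>} = {}" by auto
      have "eigenspace S E b \<mu> = {0}"
        by (simp only: span empty image_empty span_empty)
      with u \<open>u \<noteq> 0\<close> show False by simp
    qed
  qed
  fix \<mu> assume "eigenvalue S E b \<mu>"
  have on': "orthonormal {j \<in> J. l j = \<mu>} e"
    by (rule orthonormal_subset[OF on]) auto
  show "card {j \<in> J. l j = \<mu>} = dim (eigenspace S E b \<mu>)"
    unfolding span dim_span_eq_card_independent[OF orthonormal_independent[OF on']]
    by (rule card_image[OF orthonormal_inj_on[OF on'], symmetric])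
qed

end

section \<open>Spectral theory by minimizing the Rayleigh quotient\<close>

text \<open>For \<open>r \<le> c\<close> and \<open>c > 0\<close>, the choice \<open>s = - p / c\<close> gives at most \<open>- p\<^sup>2 / c\<close>.\<close>

lemma linear_coefficient_of_nonneg_quadratic:
  fixes p r :: real
  assumes "\<And>s. 0 \<le> 2 * s * p + s\<^sup>2 * r"
  shows "p = 0"
proof (rule ccontr)
  assume "p \<noteq> 0"
  define c where "c = \<bar>r\<bar> + 1"
  have "c > 0" "r \<le> c" by (auto simp: c_def)
  have "0 \<le> 2 * (- p / c) * p + (- p / c)\<^sup>2 * r"
    by (rule assms)
  also have "\<dots> \<le> 2 * (- p / c) * p + (- p / c)\<^sup>2 * c"
    using \<open>r \<le> c\<close> by (intro add_left_mono mult_left_mono) auto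
  also have "\<dots> = - (p\<^sup>2 / c)"
    using \<open>c > 0\<close> by (simp add: power2_eq_square field_simps)
  also have "\<dots> < 0"
    using \<open>c > 0\<close> \<open>p \<noteq> 0\<close> by simp
  finally show False by simp
qed

text \<open>The last assumption says, without reference to a second space, that the identity is compact from the
  given norm to the one defined by \<open>b\<close>: bounded sequences have \<open>b\<close>-Cauchy subsequences.\<close>

locale compact_form_pair = inner_form b
  for b :: "'v::{real_normed_vector,complete_space} \<Rightarrow> 'v \<Rightarrow> real" +
  fixes a :: "'v \<Rightarrow> 'v \<Rightarrow> real" and d :: real
  assumes bounded_a: "bounded_bilinear a"
    and sym_a: "a u v = a v u"
    and d_pos: "0 < d"
    and coercive: "d * (norm u)\<^sup>2 \<le> a u u"
    and compact: "bounded (range x) \<Longrightarrow> \<exists>r. strict_mono (r :: nat \<Rightarrow> nat) \<and>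
      (\<forall>e>0. \<exists>N. \<forall>i\<ge>N. \<forall>j\<ge>N. b (x (r i) - x (r j)) (x (r i) - x (r j)) < e)"
begin

sublocale a: bounded_bilinear a
  by (rule bounded_a)

lemma a_nonneg: "0 \<le> a u u"
  using coercive[of u] d_pos by (meson mult_nonneg_nonneg order_trans less_imp_le zero_le_power2)

lemma bounded_if_energy_le:
  assumes "\<And>n. a (x n) (x n) \<le> c"
  shows "bounded (range x)"
proof (rule boundedI)
  fix y assume "y \<in> range x"
  then obtain n where n: "y = x n" by auto
  have "d * (norm y)\<^sup>2 \<le> c"
    using coercive[of y] assms[of n] n by simp
  then have "(norm y)\<^sup>2 \<le> c / d"
    using d_pos by (simp add: field_simps)
  then show "norm y \<le> sqrt (c / d)"
    using real_le_rsqrt by blast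
qed

text \<open>A minimizing sequence has a \<open>b\<close>-Cauchy subsequence, and the parallelogram identity upgrades this to
  the Cauchy property for the energy \<open>a\<close>: the energy of a midpoint cannot drop below the infimum, so
  the energy of the difference is small. Coercivity and completeness then give a limit in norm.\<close>

lemma rayleigh_minimizer:
  assumes W: "subspace W" "closed W" and w: "w \<in> W" "w \<noteq> 0"
  obtains z where "z \<in> W" "b z z = 1" "\<And>v. v \<in> W \<Longrightarrow> a z z * b v v \<le> a v v"
proof -
  define R where "R = (\<lambda>v. a v v) ` {v \<in> W. b v v = 1}"
  define l where "l = Inf R"
  have R: "a v v / b v v \<in> R" if "v \<in> W" "v \<noteq> 0" for v
    using normalize[OF bounded_a that(2)] subspace_scale[OF W(1) that(1), of "1 / sqrt (b v v)"]
    unfolding R_def by (metis (mono_tags, lifting) image_eqI mem_Collect_eq)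
  have bdd: "bdd_below R"
    unfolding R_def by (rule bdd_belowI[of _ 0]) (auto simp: a_nonneg)
  have l_le: "l * b v v \<le> a v v" if "v \<in> W" for v
  proof (cases "v = 0")
    case False
    then have "l \<le> a v v / b v v"
      unfolding l_def by (intro cInf_lower R that bdd)
    then show ?thesis
      using pos[OF False] by (simp add: field_simps)
  qed (simp add: a.zero_left b.zero_left)
  have "\<exists>z. z \<in> W \<and> b z z = 1 \<and> a z z < l + inverse (real (Suc n))" for n
  proof -
    have "\<exists>r\<in>R. r < l + inverse (real (Suc n))"
      unfolding l_def using R[OF w] by (intro cInf_lessD) auto
    then show ?thesis by (auto simp: R_def)
  qed
  then obtain x where x: "\<And>n. x n \<in> W" "\<And>n. b (x n) (x n) = 1"
    "\<And>n. a (x n) (x n) < l + inverse (real (Suc n))"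
    by metis
  have "a (x n) (x n) \<le> l + 1" for n
    using x(3)[of n] inverse_le_1_iff[of "real (Suc n)"] by auto
  then have "bounded (range x)"
    by (rule bounded_if_energy_le)
  from compact[OF this] obtain r :: "nat \<Rightarrow> nat" where r: "strict_mono r"
    and cauchy_b: "\<And>e. e > 0 \<Longrightarrow> \<exists>N. \<forall>i\<ge>N. \<forall>j\<ge>N. b (x (r i) - x (r j)) (x (r i) - x (r j)) < e"
    by blast
  define y where "y n = x (r n)" for n
  have y: "y n \<in> W" "b (y n) (y n) = 1" "l \<le> a (y n) (y n)" for n
    using x l_le[of "y n"] by (auto simp: y_def)
  have a_lim: "(\<lambda>n. a (y n) (y n)) \<longlonglongrightarrow> l"
  proof (rule tendsto_sandwich[OF _ _ tendsto_const])
    show "\<forall>\<^sub>F n in sequentially. l \<le> a (y n) (y n)"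
      using y(3) by simp
    show "(\<lambda>n. l + inverse (real (Suc (r n)))) \<longlonglongrightarrow> l"
      using tendsto_add[OF tendsto_const[of l] LIMSEQ_subseq_LIMSEQ[OF LIMSEQ_inverse_real_of_nat r]]
      by (simp add: o_def)
    show "\<forall>\<^sub>F n in sequentially. a (y n) (y n) \<le> l + inverse (real (Suc (r n)))"
      using x(3) by (auto simp: y_def less_imp_le)
  qed
  have par: "a (y i - y j) (y i - y j)
      \<le> 2 * (a (y i) (y i) - l) + 2 * (a (y j) (y j) - l) + l * b (y i - y j) (y i - y j)" for i j
  proof -
    have "l * b (y i + y j) (y i + y j) \<le> a (y i + y j) (y i + y j)"
      by (intro l_le subspace_add W y)
    moreover have "b (y i + y j) (y i + y j) = 4 - b (y i - y j) (y i - y j)"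
      using y(2)[of i] y(2)[of j] by (simp add: b.add_left b.add_right b.diff_left b.diff_right)
    ultimately show ?thesis
      by (simp add: a.add_left a.add_right a.diff_left a.diff_right algebra_simps)
  qed
  have "Cauchy y"
  proof (rule CauchyI)
    fix e :: real assume "e > 0"
    define \<eta> where "\<eta> = d * e\<^sup>2 / 8"
    have \<eta>: "\<eta> > 0" using \<open>e > 0\<close> d_pos by (simp add: \<eta>_def)
    from LIMSEQ_D[OF a_lim \<eta>] obtain N1 where N1: "\<And>n. n \<ge> N1 \<Longrightarrow> \<bar>a (y n) (y n) - l\<bar> < \<eta>"
      by auto
    have "\<eta> / (\<bar>l\<bar> + 1) > 0" using \<eta> by simp
    from cauchy_b[OF this] obtain N2 where
      N2: "\<And>i j. i \<ge> N2 \<Longrightarrow> j \<ge> N2 \<Longrightarrow> b (y i - y j) (y i - y j) < \<eta> / (\<bar>l\<bar> + 1)"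
      by (auto simp: y_def)
    show "\<exists>M. \<forall>i\<ge>M. \<forall>j\<ge>M. norm (y i - y j) < e"
    proof (intro exI allI impI)
      fix i j assume "i \<ge> max N1 N2" "j \<ge> max N1 N2"
      then have A: "\<bar>a (y i) (y i) - l\<bar> < \<eta>" "\<bar>a (y j) (y j) - l\<bar> < \<eta>"
        and B: "b (y i - y j) (y i - y j) < \<eta> / (\<bar>l\<bar> + 1)"
        using N1 N2 by auto
      have "l * b (y i - y j) (y i - y j) \<le> (\<bar>l\<bar> + 1) * b (y i - y j) (y i - y j)"
        by (intro mult_right_mono nonneg) auto
      also have "\<dots> < \<eta>"
        using B by (simp add: field_simps)
      finally have C: "l * b (y i - y j) (y i - y j) < \<eta>" .
      have "T < 8 * \<eta>" if "T \<le> U" "U \<le> 2 * P + 2 * Q + R" "\<bar>P\<bar> < \<eta>" "\<bar>Q\<bar> < \<eta>" "R < \<eta>" for P Q R T U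
        using that \<eta> by linarith
      from this[OF coercive par A C] have "d * (norm (y i - y j))\<^sup>2 < 8 * \<eta>" .
      then have "(norm (y i - y j))\<^sup>2 < e\<^sup>2"
        using d_pos by (simp add: \<eta>_def)
      then show "norm (y i - y j) < e"
        using \<open>e > 0\<close> by (simp add: power_less_imp_less_base)
    qed
  qed
  then obtain z where z: "y \<longlonglongrightarrow> z"
    using Cauchy_convergent convergent_def by blast
  have "z \<in> W"
    using closed_sequentially[OF W(2) _ z] y by blast
  moreover have "b z z = 1"
    using LIMSEQ_unique[OF b.tendsto[OF z z]] y(2) by simp
  moreover have "a z z = l"
    using LIMSEQ_unique[OF a.tendsto[OF z z] a_lim] by simp
  ultimately show ?thesis
    using that l_le by auto
qed

text \<open>Along each line through the minimizer, \<open>a - l * b\<close> is a nonnegative quadratic polynomial vanishing at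
  the minimizer, so its linear coefficient is zero.\<close>

lemma minimizer_euler_lagrange:
  assumes W: "subspace W" and z: "z \<in> W" "b z z = 1"
    and min: "\<And>v. v \<in> W \<Longrightarrow> a z z * b v v \<le> a v v" and v: "v \<in> W"
  shows "a z v = a z z * b z v"
proof -
  define l where "l = a z z"
  have "0 \<le> 2 * s * (a z v - l * b z v) + s\<^sup>2 * (a v v - l * b v v)" for s
  proof -
    have "l * b (z + s *\<^sub>R v) (z + s *\<^sub>R v) \<le> a (z + s *\<^sub>R v) (z + s *\<^sub>R v)"
      unfolding l_def by (intro min subspace_add subspace_scale W z v)
    then show ?thesis
      using z(2) sym[of v z] sym_a[of v z]
      by (simp add: a.add_left a.add_right a.scaleR_left a.scaleR_right b.add_left b.add_right
          b.scaleR_left b.scaleR_right l_def algebra_simps power2_eq_square)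
  qed
  from linear_coefficient_of_nonneg_quadratic[OF this] show ?thesis
    by (simp add: l_def)
qed

lemma closed_orthogonal: "closed {v \<in> S. \<forall>g\<in>G. b v g = 0}" if "closed S" for S
proof -
  have "{v \<in> S. \<forall>g\<in>G. b v g = 0} = S \<inter> (\<Inter>g\<in>G. (\<lambda>v. b v g) -` {0})" by auto
  also have "closed \<dots>"
    by (intro closed_Int closed_INT that ballI continuous_closed_vimage)
      (auto intro: linear_continuous_at b.bounded_linear_left)
  finally show ?thesis .
qed

lemma subspace_orthogonal: "subspace {v \<in> S. \<forall>g\<in>G. b v g = 0}" if "subspace S" for S
  using that by (auto simp: subspace_def b.zero_left b.add_left b.scaleR_left)

text \<open>Each \<open>e j\<close> minimizes the Rayleigh quotient among the vectors of \<open>S\<close> orthogonal to its predecessors;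
  the dimension condition \<open>large\<close> keeps these spaces nontrivial. The minimization yields the eigenvalue
  equation only against that orthogonal space. It extends to \<open>S\<close> because, by symmetry and the equations
  of the predecessors, both forms vanish between \<open>e j\<close> and its predecessors. Numbering starts at 1,
  so the predecessors of \<open>e j\<close> are \<open>e 1, \<dots>, e (j - 1)\<close>.\<close>

lemma eigenbasis_exists:
  assumes S: "subspace S" "closed S"
    and J': "J = {1..} \<or> J = {1..n}"
    and large: "\<And>j. j \<in> J \<Longrightarrow> \<exists>F \<subseteq> S. independent F \<and> card F = j"
  obtains e :: "nat \<Rightarrow> 'v" and l :: "nat \<Rightarrow> real" where
    "\<And>j. j \<in> J \<Longrightarrow> e j \<in> S" "orthonormal J e"
    "\<And>j v. j \<in> J \<Longrightarrow> v \<in> S \<Longrightarrow> a (e j) v = l j * b (e j) v"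
    "\<And>j v. j \<in> J \<Longrightarrow> v \<in> S \<Longrightarrow> (\<And>i. 1 \<le> i \<Longrightarrow> i < j \<Longrightarrow> b v (e i) = 0) \<Longrightarrow> l j * b v v \<le> a v v"
    "mono_on J l"
proof -
  have J: "1 \<le> j" "1 \<le> i \<Longrightarrow> i \<le> j \<Longrightarrow> i \<in> J" if "j \<in> J" for i j
    using J' that by auto
  define W where "W e n = {v \<in> S. \<forall>g \<in> e ` {1..<n}. b v g = 0}" for e :: "nat \<Rightarrow> 'v" and n :: nat
  have W: "subspace (W e n)" "closed (W e n)" for e n
    unfolding W_def by (intro subspace_orthogonal closed_orthogonal S)+
  define P where "P e n z \<longleftrightarrow>
    (n \<in> J \<longrightarrow> z \<in> W e n \<and> b z z = 1 \<and> (\<forall>v \<in> W e n. a z z * b v v \<le> a v v))" for e n z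
  have "\<exists>e. \<forall>n. P e n (e n)"
  proof (rule dependent_wellorder_choice)
    fix r f g and n :: nat assume "\<And>y. y < n \<Longrightarrow> f y = (g y :: 'v)"
    then have "W f n = W g n" by (auto simp: W_def)
    then show "P f n r = P g n r" by (simp add: P_def)
  next
    fix n e
    show "\<exists>z. P e n z"
    proof (cases "n \<in> J")
      case True
      with large obtain F where F: "F \<subseteq> S" "independent F" "card F = n" by blast
      have "card (e ` {1..<n}) < card F"
        using card_image_le[of "{1..<n}" e] J(1)[OF True] F(3) by auto
      from exists_orthogonal_in_span[OF _ F(2) this] obtain w where
        w: "w \<in> span F" "w \<noteq> 0" "\<And>g. g \<in> e ` {1..<n} \<Longrightarrow> b w g = 0"
        by auto
      have "w \<in> W e n"
        using w span_minimal[OF F(1) S(1)] by (auto simp: W_def)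
      from rayleigh_minimizer[OF W this w(2)] show ?thesis
        unfolding P_def by metis
    qed (auto simp: P_def)
  qed
  then obtain e where e: "\<And>n. P e n (e n)" by blast
  define l where "l n = a (e n) (e n)" for n
  have inW: "e n \<in> W e n" and norm: "b (e n) (e n) = 1"
    and min: "\<And>v. v \<in> W e n \<Longrightarrow> l n * b v v \<le> a v v" if "n \<in> J" for n
    using e[of n] that by (auto simp: P_def l_def)
  have less: "b (e n) (e i) = 0" if "n \<in> J" "1 \<le> i" "i < n" for i n
    using inW[OF that(1)] that by (auto simp: W_def)
  have on: "orthonormal J e"
    unfolding orthonormal_def
  proof (intro ballI)
    fix i j assume "i \<in> J" "j \<in> J"
    then show "b (e i) (e j) = of_bool (i = j)"
      using less[of i j] less[of j i] norm[of i] J(1) sym[of "e i" "e j"]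
      by (cases i j rule: linorder_cases) auto
  qed
  have inS: "e j \<in> S" if "j \<in> J" for j
    using inW[OF that] by (simp add: W_def)
  have eig: "a (e j) v = l j * b (e j) v" if "j \<in> J" "v \<in> S" for j v
    using that
  proof (induction j arbitrary: v rule: less_induct)
    case (less j)
    let ?I = "{1..<j}"
    define p where "p = (\<Sum>i\<in>?I. b v (e i) *\<^sub>R e i)"
    have I: "?I \<subseteq> J" using J(2)[OF less.prems(1)] by auto
    have a0: "a (e j) (e i) = 0" "b (e j) (e i) = 0" if "i \<in> ?I" for i
    proof -
      show b0: "b (e j) (e i) = 0"
        using orthonormalD[OF on less.prems(1)] that I by auto
      have "a (e i) (e j) = l i * b (e i) (e j)"
        using that I less.prems by (intro less.IH inS) auto
      then show "a (e j) (e i) = 0"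
        using b0 sym[of "e i" "e j"] sym_a[of "e i" "e j"] by simp
    qed
    have p0: "a (e j) p = 0" "b (e j) p = 0"
      by (simp_all add: p_def a.sum_right b.sum_right a.scaleR_right b.scaleR_right a0)
    have "p \<in> S"
      unfolding p_def using I by (intro subspace_sum subspace_scale S inS) auto
    then have "v - p \<in> W e j"
      using projection_remainder_orthogonal[OF orthonormal_subset[OF on I], of _ v] less.prems(2)
      by (auto simp: W_def p_def intro: subspace_diff S)
    from minimizer_euler_lagrange[OF W(1) inW norm _ this] have "a (e j) (v - p) = l j * b (e j) (v - p)"
      using min less.prems by (simp add: l_def)
    then show ?case
      by (simp add: a.diff_right b.diff_right p0)
  qed
  have min': "l j * b v v \<le> a v v"
    if "j \<in> J" "v \<in> S" "\<And>i. 1 \<le> i \<Longrightarrow> i < j \<Longrightarrow> b v (e i) = 0" for j v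
    using min[OF that(1), of v] that by (auto simp: W_def)
  have "mono_on J l"
  proof (rule mono_onI)
    fix i j assume ij: "i \<in> J" "j \<in> J" "i \<le> j"
    have "l i * b (e j) (e j) \<le> a (e j) (e j)"
      using ij by (intro min' inS less) auto
    then show "l i \<le> l j"
      using norm[OF ij(2)] by (simp add: l_def)
  qed
  with inS on eig min' that[of e l] show ?thesis by blast
qed

text \<open>Infinitely many orthonormal vectors of bounded energy would have a \<open>b\<close>-Cauchy subsequence, but the
  square of the \<open>b\<close>-distance of two orthonormal vectors is 2.\<close>

lemma eigenvalues_unbounded:
  fixes J :: "nat set"
  assumes on: "orthonormal J e"
    and eig: "\<And>j. j \<in> J \<Longrightarrow> a (e j) (e j) = l j * b (e j) (e j)"
  shows "finite {j \<in> J. l j \<le> \<mu>}"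
proof (rule ccontr)
  assume inf: "infinite {j \<in> J. l j \<le> \<mu>}"
  define x where "x n = e (enumerate {j \<in> J. l j \<le> \<mu>} n)" for n
  have x: "\<exists>j\<in>J. l j \<le> \<mu> \<and> x n = e j" for n
    using enumerate_in_set[OF inf, of n] by (auto simp: x_def)
  have ortho: "b (x i) (x j) = of_bool (i = j)" for i j
    using enumerate_in_set[OF inf] inj_enumerate[OF inf]
    by (auto simp: x_def orthonormalD[OF on] inj_eq)
  have "a (x n) (x n) \<le> \<mu>" for n
    using x[of n] eig orthonormalD[OF on] by auto
  then have "bounded (range x)"
    by (rule bounded_if_energy_le)
  from compact[OF this] obtain r :: "nat \<Rightarrow> nat" and N where
    r: "strict_mono r" and N: "\<And>i j. i \<ge> N \<Longrightarrow> j \<ge> N \<Longrightarrow> b (x (r i) - x (r j)) (x (r i) - x (r j)) < 1"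
    using zero_less_one by blast
  have "r N \<noteq> r (Suc N)"
    using strict_mono_eq[OF r] by simp
  then have "b (x (r N) - x (r (Suc N))) (x (r N) - x (r (Suc N))) = 2"
    by (simp add: b.diff_left b.diff_right ortho)
  then show False
    using N[of N "Suc N"] by simp
qed

end

section \<open>The Courant-Fischer principle\<close>

locale spectral_pair = compact_form_pair b a d
  for b a :: "'v::{real_normed_vector,complete_space} \<Rightarrow> 'v \<Rightarrow> real" and d +
  assumes infinite_dim: "\<nexists>F :: 'v set. finite F \<and> span F = UNIV"
begin

abbreviation ev :: "nat \<Rightarrow> real" where
  "ev \<equiv> nth_eigenvalue UNIV a b"

lemma independent_of_card:
  obtains F :: "'v set" where "independent F" "card F = n"
proof -
  obtain X :: "'v set" where X: "independent X" "UNIV \<subseteq> span X"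
    using basis_exists[of UNIV] by auto
  then have "infinite X"
    using infinite_dim by auto
  then obtain F where F: "F \<subseteq> X" "card F = n"
    using infinite_arbitrarily_large by blast
  show ?thesis
    using that[OF independent_mono[OF X(1) F(1)] F(2)] .
qed

definition spectral_basis :: "(nat \<Rightarrow> 'v) \<Rightarrow> bool" where
  "spectral_basis e \<longleftrightarrow> orthonormal {1..} e \<and>
    (\<forall>j\<ge>1. \<forall>v. a (e j) v = ev j * b (e j) v) \<and>
    (\<forall>j\<ge>1. \<forall>v. (\<forall>i. 1 \<le> i \<longrightarrow> i < j \<longrightarrow> b v (e i) = 0) \<longrightarrow> ev j * b v v \<le> a v v) \<and>
    (\<forall>\<mu>. eigenspace UNIV a b \<mu> = span (e ` {j \<in> {1..}. ev j = \<mu>}))"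

lemma spectral_basisD:
  assumes "spectral_basis e"
  shows "orthonormal {1..} e"
    and "\<And>j v. 1 \<le> j \<Longrightarrow> a (e j) v = ev j * b (e j) v"
    and "\<And>j v. 1 \<le> j \<Longrightarrow> (\<And>i. 1 \<le> i \<Longrightarrow> i < j \<Longrightarrow> b v (e i) = 0) \<Longrightarrow> ev j * b v v \<le> a v v"
    and "\<And>\<mu>. eigenspace UNIV a b \<mu> = span (e ` {j \<in> {1..}. ev j = \<mu>})"
  using assms by (simp_all add: spectral_basis_def)

text \<open>An eigenvector orthogonal to all \<open>e j\<close> would have a Rayleigh quotient at least \<open>l j\<close> for every \<open>j\<close>,
  which is impossible as the \<open>l j\<close> are unbounded. Hence the family is complete, and \<open>l\<close> lists all
  eigenvalues.\<close>

lemma spectral_basis_exists: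
  obtains e where "spectral_basis e"
proof -
  have large: "\<exists>F \<subseteq> (UNIV :: 'v set). independent F \<and> card F = j" for j
    by (rule independent_of_card[of j]) blast
  obtain e :: "nat \<Rightarrow> 'v" and l where "\<And>j. j \<in> {1..} \<Longrightarrow> e j \<in> UNIV" and on: "orthonormal {1..} e"
    and eig': "\<And>j v. j \<in> {1..} \<Longrightarrow> v \<in> UNIV \<Longrightarrow> a (e j) v = l j * b (e j) v"
    and min': "\<And>j v. j \<in> {1..} \<Longrightarrow> v \<in> UNIV \<Longrightarrow>
      (\<And>i. 1 \<le> i \<Longrightarrow> i < j \<Longrightarrow> b v (e i) = 0) \<Longrightarrow> l j * b v v \<le> a v v"
    and mono: "mono_on {1..} l"
  proof (rule eigenbasis_exists[OF subspace_UNIV closed_UNIV disjI1[OF refl] large])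
    fix e :: "nat \<Rightarrow> 'v" and l assume "\<And>j. j \<in> {1..} \<Longrightarrow> e j \<in> UNIV" "orthonormal {1..} e"
      "\<And>j v. j \<in> {1..} \<Longrightarrow> v \<in> UNIV \<Longrightarrow> a (e j) v = l j * b (e j) v"
      "\<And>j v. j \<in> {1..} \<Longrightarrow> v \<in> UNIV \<Longrightarrow>
        (\<And>i. 1 \<le> i \<Longrightarrow> i < j \<Longrightarrow> b v (e i) = 0) \<Longrightarrow> l j * b v v \<le> a v v"
      "mono_on {1..} l"
    show thesis by (rule that[of e l]) fact+
  qed
  have eig: "a (e j) v = l j * b (e j) v" if "1 \<le> j" for j v
    using eig' that by simp
  have min: "l j * b v v \<le> a v v" if "1 \<le> j" "\<And>i. 1 \<le> i \<Longrightarrow> i < j \<Longrightarrow> b v (e i) = 0" for j v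
    using min'[of j v] that by simp
  have fin: "finite {j \<in> {1..}. l j \<le> \<mu>}" for \<mu>
    by (rule eigenvalues_unbounded[OF on]) (simp add: eig)
  have complete: "u = 0" if u: "u \<in> eigenspace UNIV a b \<mu>" "\<And>j. j \<in> {1..} \<Longrightarrow> b u (e j) = 0" for \<mu> u
  proof (rule ccontr)
    assume "u \<noteq> 0"
    have "l j \<le> \<mu>" if "1 \<le> j" for j
    proof -
      have "l j * b u u \<le> a u u"
        using u(2) by (intro min that) auto
      also have "\<dots> = \<mu> * b u u"
        using u(1) by (simp add: eigenspace_def)
      finally show ?thesis
        using pos[OF \<open>u \<noteq> 0\<close>] by simp
    qed
    then have "{j \<in> {1..}. l j \<le> \<mu>} = {1..}" by auto
    then show False
      using fin[of \<mu>] infinite_Ici[of "1::nat"] by simp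
  qed
  have ev: "ev j = l j" if "1 \<le> j" for j
  proof (rule nth_eigenvalue_eq[OF disjI1[OF refl] subspace_UNIV bounded_a sym_a UNIV_I on _ _ fin mono])
    show "a (e j) v = l j * b (e j) v" if "j \<in> {1..}" for j v
      using eig that by simp
    show "u = 0" if "u \<in> eigenspace UNIV a b \<mu>" "\<And>j. j \<in> {1..} \<Longrightarrow> b u (e j) = 0" for \<mu> u
      by (rule complete[OF that])
  qed (use that in simp)
  have fin': "finite {j \<in> {1..}. l j = \<mu>}" for \<mu>
    by (rule finite_subset[OF _ fin[of \<mu>]]) auto
  have "eigenspace UNIV a b \<mu> = span (e ` {j \<in> {1..}. l j = \<mu>})" for \<mu>
    using eig by (intro eigenspace_eq_span subspace_UNIV bounded_a sym_a on fin' complete) auto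
  moreover have "{j \<in> {1..}. l j = \<mu>} = {j \<in> {1..}. ev j = \<mu>}" for \<mu>
    using ev by auto
  ultimately have "spectral_basis e"
    unfolding spectral_basis_def using on eig min by (simp add: ev)
  then show ?thesis by (rule that)
qed

lemma ev_mono:
  assumes "1 \<le> i" "i \<le> j"
  shows "ev i \<le> ev j"
proof -
  obtain e where e: "spectral_basis e" by (rule spectral_basis_exists)
  have "ev i * b (e j) (e j) \<le> a (e j) (e j)"
    using assms orthonormalD[OF spectral_basisD(1)[OF e], of j]
    by (intro spectral_basisD(3)[OF e]) auto
  then show ?thesis
    using assms orthonormalD[OF spectral_basisD(1)[OF e], of j j] spectral_basisD(2)[OF e, of j "e j"]
    by simp
qed

text \<open>A \<open>j\<close>-dimensional space contains a nonzero vector orthogonal to the first \<open>j - 1\<close> eigenvectors; there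
  the Rayleigh quotient is at least \<open>ev j\<close>.\<close>

lemma ev_le_if_subspace:
  assumes F: "independent F" "card F = j" "1 \<le> j"
    and le: "\<And>v. v \<in> span F \<Longrightarrow> a v v \<le> \<mu> * b v v"
  shows "ev j \<le> \<mu>"
proof -
  obtain e where "spectral_basis e" by (rule spectral_basis_exists)
  note min = spectral_basisD(3)[OF this F(3)]
  have "card (e ` {1..<j}) < card F"
    using card_image_le[of "{1..<j}" e] F by auto
  from exists_orthogonal_in_span[OF _ F(1) this] obtain v where
    v: "v \<in> span F" "v \<noteq> 0" "\<And>g. g \<in> e ` {1..<j} \<Longrightarrow> b v g = 0"
    by auto
  have "ev j * b v v \<le> a v v"
    using v(3) by (intro min) auto
  also have "\<dots> \<le> \<mu> * b v v"
    by (rule le[OF v(1)])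
  finally show ?thesis
    using pos[OF v(2)] by simp
qed

lemma ev_attained_on_subspace:
  assumes "1 \<le> j"
  obtains F where "independent F" "card F = j" "\<And>v. v \<in> span F \<Longrightarrow> a v v \<le> ev j * b v v"
proof -
  obtain e where "spectral_basis e" by (rule spectral_basis_exists)
  note e = spectral_basisD[OF this]
  have on: "orthonormal {1..j} e"
    by (rule orthonormal_subset[OF e(1)]) auto
  have "a v v \<le> ev j * b v v" if "v \<in> span (e ` {1..j})" for v
    by (rule diagonal_form_le[OF on _ that bounded_a, of ev])
      (auto simp: e(2) intro: ev_mono)
  then show ?thesis
    using that orthonormal_independent[OF on] card_image[OF orthonormal_inj_on[OF on]] by simp
qed

text \<open>Orthogonality is measured by an unrelated form \<open>b'\<close>, because the complement used for a perturbed pair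
  is the one of the unperturbed eigenvectors with respect to the unperturbed form.\<close>

lemma ev_ge_if_orthogonal:
  assumes "1 \<le> j" "inner_form b'" "finite G" "card G < j"
    and ge: "\<And>v. (\<And>g. g \<in> G \<Longrightarrow> b' v g = 0) \<Longrightarrow> \<mu> * b v v \<le> a v v"
  shows "\<mu> \<le> ev j"
proof -
  obtain F where F: "independent F" "card F = j" "\<And>v. v \<in> span F \<Longrightarrow> a v v \<le> ev j * b v v"
    using ev_attained_on_subspace[OF assms(1)] by blast
  obtain v where v: "v \<in> span F" "v \<noteq> 0" "\<And>g. g \<in> G \<Longrightarrow> b' v g = 0"
    using inner_form.exists_orthogonal_in_span[OF assms(2,3) F(1)] assms(4) F(2) by metis
  have "\<mu> * b v v \<le> ev j * b v v"
    using ge[OF v(3)] F(3)[OF v(1)] by simp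
  then show ?thesis
    using pos[OF v(2)] by simp
qed

lemma ev_pos:
  assumes "1 \<le> j"
  shows "0 < ev j"
proof -
  obtain e where "spectral_basis e" by (rule spectral_basis_exists)
  note e = spectral_basisD[OF this]
  have 1: "b (e j) (e j) = 1"
    using orthonormalD[OF e(1), of j j] assms by simp
  then have "e j \<noteq> 0" using b.zero_left by force
  then have "0 < d * (norm (e j))\<^sup>2" using d_pos by simp
  then show ?thesis using coercive[of "e j"] e(2)[OF assms, of "e j"] 1 by simp
qed

end

section \<open>First-order perturbation of a degenerate form\<close>

text \<open>For \<open>p = norm w\<close> and \<open>r = norm y\<close>, the cross terms of \<open>h * D\<close> have size \<open>h * p * r\<close>. Half of the gain
  \<open>h * c * r\<^sup>2\<close> absorbs them up to a multiple of \<open>h * p\<^sup>2\<close>, which \<open>g * p\<^sup>2\<close> controls once \<open>h\<close> is small;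
  the other half and \<open>g * p\<^sup>2\<close> absorb the remainder. The threshold for \<open>h\<close> does not depend on \<open>w\<close>
  and \<open>y\<close>, as the min-max principle requires.\<close>

lemma perturbed_form_nonneg:
  fixes S D :: "'v::real_normed_vector \<Rightarrow> 'v \<Rightarrow> real"
  assumes S: "bounded_bilinear S" "\<And>u v. S u v = S v u" and D: "bounded_bilinear D"
    and g: "0 < g" "\<And>w. w \<in> W \<Longrightarrow> g * (norm w)\<^sup>2 \<le> S w w"
    and ker: "\<And>y v. y \<in> Y \<Longrightarrow> S y v = 0"
    and c: "0 < c" "\<And>y. y \<in> Y \<Longrightarrow> c * (norm y)\<^sup>2 \<le> D y y"
    and R: "\<And>\<sigma>. 0 < \<sigma> \<Longrightarrow> \<forall>\<^sub>F h in at_right 0. \<forall>v. \<bar>R h v\<bar> \<le> \<sigma> * h * (norm v)\<^sup>2"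
  shows "\<forall>\<^sub>F h in at_right 0. \<forall>w\<in>W. \<forall>y\<in>Y.
    0 \<le> S (w + y) (w + y) + h * D (w + y) (w + y) + R h (w + y)"
proof -
  interpret S: bounded_bilinear S by (rule S)
  interpret D: bounded_bilinear D by (rule D)
  obtain K where K: "0 < K" "\<And>u v. \<bar>D u v\<bar> \<le> norm u * norm v * K"
    using D.pos_bounded unfolding real_norm_def by blast
  \<comment> \<open>\<open>2 * K\<^sup>2 / c\<close> pays for completing the square in the cross terms, \<open>K\<close> for \<open>D w w\<close>, \<open>c / 2\<close> for \<open>R\<close>.\<close>
  define L where "L = 2 * K\<^sup>2 / c + K + c / 2"
  have "L > 0" using K c by (auto simp: L_def intro!: add_pos_pos)
  have "\<forall>\<^sub>F h in at_right 0. 0 < h \<and> h < g / L"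
    using divide_pos_pos[OF g(1) \<open>L > 0\<close>] unfolding eventually_at_right_field by blast
  moreover have "\<forall>\<^sub>F h in at_right 0. \<forall>v. \<bar>R h v\<bar> \<le> c / 4 * h * (norm v)\<^sup>2"
    using c by (intro R) auto
  ultimately show ?thesis
  proof eventually_elim
    case (elim h)
    then have h: "0 < h" "h * L < g" using \<open>L > 0\<close> by (auto simp: field_simps)
    show ?case
    proof (intro ballI)
      fix w y assume w: "w \<in> W" and y: "y \<in> Y"
      define p r where "p = norm w" and "r = norm y"
      have Sv: "g * p\<^sup>2 \<le> S (w + y) (w + y)"
        using g(2)[OF w] ker[OF y] S(2)[of w y] by (simp add: S.add_left S.add_right p_def)
      have "\<bar>D w w\<bar> \<le> p * p * K" "\<bar>D w y\<bar> \<le> p * r * K" "\<bar>D y w\<bar> \<le> r * p * K"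
        using K(2) by (auto simp: p_def r_def)
      then have "c * r\<^sup>2 - 2 * K * (p * r) - K * p\<^sup>2 \<le> D (w + y) (w + y)"
        using c(2)[OF y] by (simp add: D.add_left D.add_right r_def power2_eq_square algebra_simps)
      then have Dv: "h * (c * r\<^sup>2 - 2 * K * (p * r) - K * p\<^sup>2) \<le> h * D (w + y) (w + y)"
        using h by (intro mult_left_mono) auto
      have "(norm (w + y))\<^sup>2 \<le> (p + r)\<^sup>2"
        unfolding p_def r_def by (intro power_mono norm_triangle_ineq) auto
      also have "\<dots> \<le> 2 * p\<^sup>2 + 2 * r\<^sup>2"
        using zero_le_power2[of "p - r"] by (simp add: power2_diff power2_sum)
      finally have "c / 4 * h * (norm (w + y))\<^sup>2 \<le> c / 4 * h * (2 * p\<^sup>2 + 2 * r\<^sup>2)"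
        using h c by (intro mult_left_mono) auto
      moreover have "\<bar>R h (w + y)\<bar> \<le> c / 4 * h * (norm (w + y))\<^sup>2"
        using elim by blast
      ultimately have Rv: "- (h * (c / 2 * (p\<^sup>2 + r\<^sup>2))) \<le> R h (w + y)"
        by (simp add: algebra_simps)
      have "0 \<le> c / 2 * (r - 2 * K / c * p)\<^sup>2"
        using c by simp
      also have "\<dots> = c / 2 * r\<^sup>2 - 2 * K * (p * r) + 2 * K\<^sup>2 / c * p\<^sup>2"
        using c by (simp add: power2_diff power_mult_distrib power_divide field_simps power2_eq_square)
      finally have "- (L * p\<^sup>2) \<le> c * r\<^sup>2 - 2 * K * (p * r) - K * p\<^sup>2 - c / 2 * (p\<^sup>2 + r\<^sup>2)"
        by (simp add: L_def algebra_simps)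
      then have "h * - (L * p\<^sup>2)
          \<le> h * (c * r\<^sup>2 - 2 * K * (p * r) - K * p\<^sup>2 - c / 2 * (p\<^sup>2 + r\<^sup>2))"
        using h by (intro mult_left_mono) auto
      moreover have "h * L * p\<^sup>2 \<le> g * p\<^sup>2"
        using h by (intro mult_right_mono) auto
      ultimately show "0 \<le> S (w + y) (w + y) + h * D (w + y) (w + y) + R h (w + y)"
        using Sv Dv Rv by (simp add: algebra_simps)
    qed
  qed
qed

lemma bounded_bilinear_diff_scaled:
  fixes f g :: "'a::real_normed_vector \<Rightarrow> 'b::real_normed_vector \<Rightarrow> real"
  assumes f: "bounded_bilinear f" and g: "bounded_bilinear g"
  shows "bounded_bilinear (\<lambda>u v. f u v - c * g u v)"
proof -
  interpret f: bounded_bilinear f by (rule f)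
  interpret g: bounded_bilinear g by (rule g)
  obtain K where K: "\<And>u v. norm (f u v) \<le> norm u * norm v * K"
    using f.bounded by blast
  obtain L where L: "\<And>u v. norm (g u v) \<le> norm u * norm v * L"
    using g.bounded by blast
  show ?thesis
  proof
    show "\<exists>M. \<forall>u v. norm (f u v - c * g u v) \<le> norm u * norm v * M"
    proof (intro exI allI)
      fix u v
      have "norm (f u v - c * g u v) \<le> norm (f u v) + \<bar>c\<bar> * norm (g u v)"
        by (rule order_trans[OF norm_triangle_ineq4]) (simp add: abs_mult)
      also have "\<dots> \<le> norm u * norm v * K + \<bar>c\<bar> * (norm u * norm v * L)"
        by (intro add_mono mult_left_mono K L) auto
      finally show "norm (f u v - c * g u v) \<le> norm u * norm v * (K + \<bar>c\<bar> * L)"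
        by (simp add: algebra_simps)
    qed
  qed (simp_all add: f.add_left f.add_right f.scaleR_left f.scaleR_right
      g.add_left g.add_right g.scaleR_left g.scaleR_right algebra_simps)
qed

lemma bounded_bilinear_uminus:
  fixes f :: "'a::real_normed_vector \<Rightarrow> 'b::real_normed_vector \<Rightarrow> real"
  assumes "bounded_bilinear f"
  shows "bounded_bilinear (\<lambda>u v. - f u v)"
  using bounded_bilinear_diff_scaled[OF assms assms, of 2] by simp

context spectral_pair
begin

text \<open>The remainder consists of the two remainders of \<open>ah\<close> and \<open>bh\<close>, the latter times the bounded factor
  \<open>\<kappa> + h * \<nu>\<close>, and the product \<open>h\<^sup>2 * \<nu> * b'\<close> of the two first-order terms; each is given a third of
  \<open>\<sigma>\<close>.\<close>

lemma first_order_remainder: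
  fixes ah bh :: "real \<Rightarrow> 'v \<Rightarrow> 'v \<Rightarrow> real"
  assumes b': "bounded_bilinear b'"
    and da: "\<And>\<sigma>. 0 < \<sigma> \<Longrightarrow>
      \<forall>\<^sub>F h in at_right 0. \<forall>v. \<bar>ah h v v - a v v - h * a' v v\<bar> \<le> \<sigma> * h * (norm v)\<^sup>2"
    and db: "\<And>\<sigma>. 0 < \<sigma> \<Longrightarrow>
      \<forall>\<^sub>F h in at_right 0. \<forall>v. \<bar>bh h v v - b v v - h * b' v v\<bar> \<le> \<sigma> * h * (norm v)\<^sup>2"
    and \<sigma>: "0 < \<sigma>"
  shows "\<forall>\<^sub>F h in at_right 0. \<forall>v.
    \<bar>(ah h v v - (\<kappa> + h * \<nu>) * bh h v v)
      - ((a v v - \<kappa> * b v v) + h * (a' v v - \<kappa> * b' v v - \<nu> * b v v))\<bar> \<le> \<sigma> * h * (norm v)\<^sup>2"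
proof -
  obtain K where K: "0 < K" "\<And>u v. \<bar>b' u v\<bar> \<le> norm u * norm v * K"
    using bounded_bilinear.pos_bounded[OF b'] unfolding real_norm_def by blast
  define L M where "L = \<bar>\<kappa>\<bar> + 1" and "M = \<bar>\<nu>\<bar> * K + 1"
  have LM: "L > 0" "M > 0" using K by (auto simp: L_def M_def intro: add_nonneg_pos)
  have "\<forall>\<^sub>F h in at_right (0::real). 0 < h \<and> h < c" if "0 < c" for c
    using that unfolding eventually_at_right_field by blast
  then have "\<forall>\<^sub>F h in at_right (0::real). 0 < h \<and> h < 1 / (\<bar>\<nu>\<bar> + 1)"
    "\<forall>\<^sub>F h in at_right (0::real). 0 < h \<and> h < \<sigma> / (3 * M)"
    using LM \<sigma> by simp_all
  moreover have "\<forall>\<^sub>F h in at_right 0. \<forall>v. \<bar>ah h v v - a v v - h * a' v v\<bar> \<le> \<sigma> / 3 * h * (norm v)\<^sup>2"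
    using \<sigma> by (intro da) auto
  moreover have "\<forall>\<^sub>F h in at_right 0. \<forall>v.
      \<bar>bh h v v - b v v - h * b' v v\<bar> \<le> \<sigma> / (3 * L) * h * (norm v)\<^sup>2"
    using \<sigma> LM by (intro db) auto
  ultimately show ?thesis
  proof eventually_elim
    case (elim h)
    then have h: "0 < h" "h * (\<bar>\<nu>\<bar> + 1) < 1" "h * M < \<sigma> / 3"
      using LM by (auto simp: field_simps)
    show ?case
    proof
      fix v
      define ra rb where "ra = ah h v v - a v v - h * a' v v" and "rb = bh h v v - b v v - h * b' v v"
      define n where "n = (norm v)\<^sup>2"
      have n: "0 \<le> n" by (simp add: n_def)
      have ra: "\<bar>ra\<bar> \<le> \<sigma> / 3 * h * n"
        using elim(3) by (simp add: ra_def n_def)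
      have "\<bar>\<kappa> + h * \<nu>\<bar> \<le> \<bar>\<kappa>\<bar> + h * \<bar>\<nu>\<bar>"
        using abs_triangle_ineq[of \<kappa> "h * \<nu>"] h by (simp add: abs_mult)
      also have "\<dots> \<le> L"
        using h by (simp add: L_def algebra_simps)
      finally have "\<bar>\<kappa> + h * \<nu>\<bar> * \<bar>rb\<bar> \<le> L * (\<sigma> / (3 * L) * h * n)"
        using elim(4) LM by (intro mult_mono) (auto simp: rb_def n_def)
      then have rb: "\<bar>(\<kappa> + h * \<nu>) * rb\<bar> \<le> \<sigma> / 3 * h * n"
        using LM by (simp add: abs_mult)
      have "\<bar>b' v v\<bar> \<le> K * n"
        using K(2)[of v v] by (simp add: n_def power2_eq_square mult_ac)
      then have "\<bar>\<nu>\<bar> * \<bar>b' v v\<bar> \<le> \<bar>\<nu>\<bar> * (K * n)"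
        by (intro mult_left_mono) auto
      also have "\<dots> \<le> M * n"
        using n by (simp add: M_def algebra_simps)
      finally have "h * h * (\<bar>\<nu>\<bar> * \<bar>b' v v\<bar>) \<le> h * h * (M * n)"
        by (intro mult_left_mono) auto
      also have "\<dots> = (h * M) * (h * n)" by simp
      also have "\<dots> \<le> \<sigma> / 3 * (h * n)"
        using h n by (intro mult_right_mono) auto
      finally have rc: "\<bar>h * h * (\<nu> * b' v v)\<bar> \<le> \<sigma> / 3 * h * n"
        using h by (simp add: abs_mult)
      have "(ah h v v - (\<kappa> + h * \<nu>) * bh h v v)
          - ((a v v - \<kappa> * b v v) + h * (a' v v - \<kappa> * b' v v - \<nu> * b v v))
        = ra - (\<kappa> + h * \<nu>) * rb - h * h * (\<nu> * b' v v)"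
        by (simp add: ra_def rb_def algebra_simps)
      also have "\<bar>\<dots>\<bar> \<le> \<bar>ra\<bar> + \<bar>(\<kappa> + h * \<nu>) * rb\<bar> + \<bar>h * h * (\<nu> * b' v v)\<bar>"
        by linarith
      also have "\<dots> \<le> \<sigma> * h * n"
        using ra rb rc by linarith
      finally show "\<bar>(ah h v v - (\<kappa> + h * \<nu>) * bh h v v)
          - ((a v v - \<kappa> * b v v) + h * (a' v v - \<kappa> * b' v v - \<nu> * b v v))\<bar> \<le> \<sigma> * h * (norm v)\<^sup>2"
        by (simp add: n_def)
    qed
  qed
qed

section \<open>One-sided derivatives of a multiple eigenvalue\<close>

text \<open>Only \<open>h > 0\<close> enters, and the diagonalizing basis \<open>y\<close> is a parameter, so that the reversed family can
  be treated with the same vectors in reversed order.\<close>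

theorem eigenvalue_right_derivative:
  fixes ah bh :: "real \<Rightarrow> 'v \<Rightarrow> 'v \<Rightarrow> real" and k m q :: nat and \<kappa> :: real
  assumes pair: "\<forall>\<^sub>F h in at_right 0. spectral_pair (bh h) (ah h) d"
    and a': "bounded_bilinear a'" and b': "bounded_bilinear b'"
    and da: "\<And>\<sigma>. 0 < \<sigma> \<Longrightarrow>
      \<forall>\<^sub>F h in at_right 0. \<forall>v. \<bar>ah h v v - a v v - h * a' v v\<bar> \<le> \<sigma> * h * (norm v)\<^sup>2"
    and db: "\<And>\<sigma>. 0 < \<sigma> \<Longrightarrow>
      \<forall>\<^sub>F h in at_right 0. \<forall>v. \<bar>bh h v v - b v v - h * b' v v\<bar> \<le> \<sigma> * h * (norm v)\<^sup>2"
    and k: "1 \<le> k" and gap_left: "k = 1 \<or> ev (k - 1) < \<kappa>"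
    and cluster: "\<And>i. i \<in> {k..k + m - 1} \<Longrightarrow> ev i = \<kappa>"
    and gap_right: "\<kappa> < ev (k + m)" and \<kappa>: "0 < \<kappa>"
    and y: "orthonormal {1..m} y" and Y: "eigenspace UNIV a b \<kappa> = span (y ` {1..m})"
    and diag: "\<And>i j. i \<in> {1..m} \<Longrightarrow> j \<in> {1..m} \<Longrightarrow>
      a' (y i) (y j) - \<kappa> * b' (y i) (y j) = \<mu> i * b (y i) (y j)"
    and mono: "mono_on {1..m} \<mu>" and q: "q \<in> {1..m}"
  shows "((\<lambda>h. (nth_eigenvalue UNIV (ah h) (bh h) (k + q - 1) - \<kappa>) / h) \<longlongrightarrow> \<mu> q) (at_right 0)"
proof -
  interpret a': bounded_bilinear a' by (rule a')
  interpret b': bounded_bilinear b' by (rule b')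
  define E where "E u v = a' u v - \<kappa> * b' u v" for u v
  have E: "bounded_bilinear E"
    unfolding E_def by (rule bounded_bilinear_diff_scaled[OF a' b'])
  define S where "S u v = a u v - \<kappa> * b u v" for u v
  have S: "bounded_bilinear S" "S u v = S v u" for u v
    unfolding S_def
    by (rule bounded_bilinear_diff_scaled[OF bounded_a bounded]) (simp add: sym[of u v] sym_a[of u v])
  have SY: "S u v = 0" if "u \<in> span (y ` {1..m})" for u v
    using that unfolding Y[symmetric] by (simp add: S_def eigenspace_def)
  obtain e where basis: "spectral_basis e" by (rule spectral_basis_exists)
  note e = spectral_basisD(1)[OF basis] and eig = spectral_basisD(2)[OF basis]
    and min = spectral_basisD(3)[OF basis] and eigsp = spectral_basisD(4)[OF basis]
  have eY: "e i \<in> span (y ` {1..m})" if "1 \<le> i" "ev i = \<kappa>" for i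
    unfolding Y[symmetric] eigsp using that by (intro span_base) auto
  have low: "ev i < \<kappa>" if "1 \<le> i" "i < k" for i
  proof -
    have "k \<noteq> 1" "i \<le> k - 1" using that by linarith+
    then show ?thesis using gap_left that ev_mono[of i "k - 1"] by fastforce
  qed
  have orth_low: "b u (e i) = 0" if "1 \<le> i" "i < k" "u \<in> span (y ` {1..m})" for u i
  proof -
    have "b (e i) u = 0"
    proof (rule orthogonal_to_span)
      show "u \<in> span (e ` {j \<in> {1..}. ev j = \<kappa>})"
        using that(3) unfolding Y[symmetric] eigsp .
      fix g assume "g \<in> e ` {j \<in> {1..}. ev j = \<kappa>}"
      then show "b (e i) g = 0"
        using low[OF that(1,2)] that(1) orthonormalD[OF e, of i] by force
    qed
    then show ?thesis by (simp add: sym)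
  qed
  have bY: "d / \<kappa> * (norm u)\<^sup>2 \<le> b u u" if "u \<in> span (y ` {1..m})" for u
  proof -
    have "a u u = \<kappa> * b u u"
      using SY[OF that, of u] by (simp add: S_def)
    then show ?thesis
      using coercive[of u] \<kappa> by (simp add: field_simps)
  qed
  define j where "j = k + q - 1"
  have j: "1 \<le> j" using k q by (auto simp: j_def)
  define D where "D \<nu> u v = E u v - \<nu> * b u v" for \<nu> u v
  have D: "bounded_bilinear (D \<nu>)" for \<nu>
    unfolding D_def by (rule bounded_bilinear_diff_scaled[OF E bounded])
  define Q where "Q \<nu> h v = ah h v v - (\<kappa> + h * \<nu>) * bh h v v" for \<nu> h v
  define R where "R \<nu> h v = Q \<nu> h v - (S v v + h * D \<nu> v v)" for \<nu> h v
  have R: "\<forall>\<^sub>F h in at_right 0. \<forall>v. \<bar>R \<nu> h v\<bar> \<le> \<sigma> * h * (norm v)\<^sup>2" if "0 < \<sigma>" for \<sigma> \<nu>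
    unfolding R_def Q_def S_def D_def E_def 
    by (rule first_order_remainder[where ah = ah and bh = bh and a' = a' and b' = b'])
      (fact b', erule da, erule db, rule that)
  \<comment> \<open>Split a vector orthogonal to the lower eigenvectors and to the \<open>y i\<close> with \<open>i < q\<close> into its component
      in the span of the remaining \<open>y i\<close>, where \<open>D \<nu>\<close> is positive, and a rest orthogonal to all
      eigenvectors below number \<open>k + m\<close>, where the spectral gap makes \<open>S\<close> positive.\<close>
  have lower: "\<forall>\<^sub>F h in at_right 0. \<kappa> + h * (\<mu> q - \<epsilon>) \<le> nth_eigenvalue UNIV (ah h) (bh h) j"
    if \<epsilon>: "0 < \<epsilon>" for \<epsilon>
  proof -
    define \<nu> where "\<nu> = \<mu> q - \<epsilon>"
    define W where "W = {z. \<forall>i. 1 \<le> i \<and> i < k + m \<longrightarrow> b z (e i) = 0}"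
    define Yq where "Yq = span (y ` {q..m})"
    have Yq: "u \<in> span (y ` {1..m})" if "u \<in> Yq" for u
      using that q span_mono[OF image_mono[of "{q..m}" "{1..m}" y]] by (auto simp: Yq_def)
    define \<kappa>' where "\<kappa>' = ev (k + m)"
    have \<kappa>': "\<kappa> < \<kappa>'" "0 < \<kappa>'" using gap_right \<kappa> by (auto simp: \<kappa>'_def)
    have ev: "\<forall>\<^sub>F h in at_right 0. \<forall>w\<in>W. \<forall>u\<in>Yq.
      0 \<le> S (w + u) (w + u) + h * D \<nu> (w + u) (w + u) + R \<nu> h (w + u)"
    proof (rule perturbed_form_nonneg[OF S D _ _ _ _ _ R])
      show "0 < (1 - \<kappa> / \<kappa>') * d"
        using \<kappa>' d_pos by simp
      show "(1 - \<kappa> / \<kappa>') * d * (norm w)\<^sup>2 \<le> S w w" if "w \<in> W" for w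
      proof -
        have "\<kappa>' * b w w \<le> a w w"
          unfolding \<kappa>'_def using that k by (intro min) (auto simp: W_def)
        then have "\<kappa> / \<kappa>' * (\<kappa>' * b w w) \<le> \<kappa> / \<kappa>' * a w w"
          using \<kappa>' \<kappa> by (intro mult_left_mono) auto
        then have "(1 - \<kappa> / \<kappa>') * a w w \<le> S w w"
          using \<kappa>' by (simp add: S_def algebra_simps)
        moreover have "(1 - \<kappa> / \<kappa>') * (d * (norm w)\<^sup>2) \<le> (1 - \<kappa> / \<kappa>') * a w w"
          using \<kappa>' by (intro mult_left_mono coercive) auto
        ultimately show ?thesis by simp
      qed
      show "S u v = 0" if "u \<in> Yq" for u v
        by (rule SY[OF Yq[OF that]])
      show "0 < \<epsilon> * (d / \<kappa>)"
        using \<epsilon> d_pos \<kappa> by simp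
      show "\<epsilon> * (d / \<kappa>) * (norm u)\<^sup>2 \<le> D \<nu> u u" if "u \<in> Yq" for u
      proof -
        have "\<mu> q * b u u \<le> E u u"
        proof (rule diagonal_form_ge[where I = "{q..m}" and f = y and \<mu> = \<mu> and E = E])
          show "orthonormal {q..m} y"
            using q by (intro orthonormal_subset[OF y]) auto
          show "u \<in> span (y ` {q..m})" using that by (simp add: Yq_def)
          show "E (y i) (y j) = \<mu> i * b (y i) (y j)" if "i \<in> {q..m}" "j \<in> {q..m}" for i j
            unfolding E_def using that q by (intro diag) auto
          show "\<mu> q \<le> \<mu> i" if "i \<in> {q..m}" for i
            using mono q that by (auto simp: mono_on_def)
        qed (auto intro: E)
        then have "\<epsilon> * b u u \<le> D \<nu> u u"
          by (simp add: D_def \<nu>_def algebra_simps)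
        moreover have "\<epsilon> * (d / \<kappa> * (norm u)\<^sup>2) \<le> \<epsilon> * b u u"
          using \<epsilon> by (intro mult_left_mono bY Yq that) auto
        ultimately show ?thesis by simp
      qed
    qed
    from ev pair show ?thesis
    proof eventually_elim
      case (elim h)
      let ?G = "e ` {1..<k} \<union> y ` {1..<q}"
      show ?case
      proof (rule spectral_pair.ev_ge_if_orthogonal[OF elim(2) j inner_form_axioms])
        show "finite ?G" by simp
        have "card ?G \<le> card (e ` {1..<k}) + card (y ` {1..<q})"
          by (rule card_Un_le)
        also have "\<dots> \<le> (k - 1) + (q - 1)"
          using card_image_le[of "{1..<k}" e] card_image_le[of "{1..<q}" y] by simp
        also have "\<dots> < j"
          using k q by (auto simp: j_def)
        finally show "card ?G < j" .
        fix v assume v: "\<And>g. g \<in> ?G \<Longrightarrow> b v g = 0"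
        define u where "u = (\<Sum>i\<in>{q..m}. b v (y i) *\<^sub>R y i)"
        have u: "u \<in> Yq"
          unfolding Yq_def u_def by (intro span_sum span_scale span_base) auto
        have orth_y: "b (v - u) (y i) = 0" if i: "i \<in> {1..m}" for i
        proof (cases "i < q")
          case True
          have "b (y i) u = 0"
            using u unfolding Yq_def
          proof (rule orthogonal_to_span[rotated])
            fix g assume "g \<in> y ` {q..m}"
            then show "b (y i) g = 0"
              using True i q by (auto simp: orthonormalD[OF y])
          qed
          moreover have "b v (y i) = 0"
            using v True i by auto
          ultimately show ?thesis
            by (simp add: b.diff_left sym[of u])
        next
          case False
          then show ?thesis
            unfolding u_def using i q
            by (intro projection_remainder_orthogonal orthonormal_subset[OF y]) auto
        qed
        have "v - u \<in> W"
          unfolding W_def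
        proof (intro CollectI allI impI)
          fix i assume i: "1 \<le> i \<and> i < k + m"
          show "b (v - u) (e i) = 0"
          proof (cases "ev i = \<kappa>")
            case True
            then have "e i \<in> span (y ` {1..m})"
              using eY[of i] i by simp
            then show ?thesis
              by (rule orthogonal_to_span[rotated]) (use orth_y in auto)
          next
            case False
            then have "i < k" using cluster[of i] i by fastforce
            moreover from this have "b v (e i) = 0"
              using v i by auto
            ultimately show ?thesis
              using orth_low[of i u] i Yq[OF u] by (simp add: b.diff_left)
          qed
        qed
        then have "0 \<le> S v v + h * D \<nu> v v + R \<nu> h v"
          using elim(1) u by fastforce
        then show "(\<kappa> + h * (\<mu> q - \<epsilon>)) * bh h v v \<le> ah h v v"
          by (simp add: R_def Q_def \<nu>_def)
      qed
    qed
  qed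
  \<comment> \<open>The same estimate for the negated forms, on the span of the lower eigenvectors and \<open>y 1, \<dots>, y q\<close>.\<close>
  have upper: "\<forall>\<^sub>F h in at_right 0. nth_eigenvalue UNIV (ah h) (bh h) j \<le> \<kappa> + h * (\<mu> q + \<epsilon>)"
    if \<epsilon>: "0 < \<epsilon>" for \<epsilon>
  proof -
    define \<nu> where "\<nu> = \<mu> q + \<epsilon>"
    define W where "W = span (e ` {1..<k})"
    define Yq where "Yq = span (y ` {1..q})"
    have Yq: "u \<in> span (y ` {1..m})" if "u \<in> Yq" for u
      using that q span_mono[OF image_mono[of "{1..q}" "{1..m}" y]] by (auto simp: Yq_def)
    \<comment> \<open>For \<open>k = 1\<close> the space \<open>W\<close> is zero, and any positive constant serves.\<close>
    define g where "g = (if k = 1 then 1 else (\<kappa> / ev (k - 1) - 1) * d)"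
    have below: "0 < ev (k - 1)" "ev (k - 1) < \<kappa>" if "k \<noteq> 1"
      using that k gap_left ev_pos[of "k - 1"] by auto
    have ev: "\<forall>\<^sub>F h in at_right 0. \<forall>w\<in>W. \<forall>u\<in>Yq.
      0 \<le> - S (w + u) (w + u) + h * - D \<nu> (w + u) (w + u) + - R \<nu> h (w + u)"
    proof (rule perturbed_form_nonneg[OF bounded_bilinear_uminus[OF S(1)] _ bounded_bilinear_uminus[OF D]])
      show "- S u v = - S v u" for u v
        by (simp add: S(2)[of u v])
      show "0 < g"
        using below d_pos by (auto simp: g_def)
      show "g * (norm w)\<^sup>2 \<le> - S w w" if w: "w \<in> W" for w
      proof (cases "k = 1")
        case True
        with w have "w = 0" by (simp add: W_def)
        then show ?thesis by (simp add: S_def a.zero_left b.zero_left)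
      next
        case False
        have "a w w \<le> ev (k - 1) * b w w"
        proof (rule diagonal_form_le[where I = "{1..<k}" and f = e and \<mu> = ev and E = a])
          show "orthonormal {1..<k} e"
            by (rule orthonormal_subset[OF e]) auto
          show "w \<in> span (e ` {1..<k})" using w by (simp add: W_def)
        qed (auto intro: bounded_a eig ev_mono)
        then have "\<kappa> / ev (k - 1) * a w w \<le> \<kappa> / ev (k - 1) * (ev (k - 1) * b w w)"
          using below[OF False] by (intro mult_left_mono) auto
        then have "(\<kappa> / ev (k - 1) - 1) * a w w \<le> - S w w"
          using below[OF False] by (simp add: S_def algebra_simps)
        moreover have "(\<kappa> / ev (k - 1) - 1) * (d * (norm w)\<^sup>2) \<le> (\<kappa> / ev (k - 1) - 1) * a w w"
          using below[OF False] by (intro mult_left_mono coercive) auto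
        ultimately show ?thesis
          using False by (simp add: g_def)
      qed
      show "- S u v = 0" if "u \<in> Yq" for u v
        using SY[OF Yq[OF that]] by simp
      show "0 < \<epsilon> * (d / \<kappa>)"
        using \<epsilon> d_pos \<kappa> by simp
      show "\<epsilon> * (d / \<kappa>) * (norm u)\<^sup>2 \<le> - D \<nu> u u" if "u \<in> Yq" for u
      proof -
        have "E u u \<le> \<mu> q * b u u"
        proof (rule diagonal_form_le[where I = "{1..q}" and f = y and \<mu> = \<mu> and E = E])
          show "orthonormal {1..q} y"
            using q by (intro orthonormal_subset[OF y]) auto
          show "u \<in> span (y ` {1..q})" using that by (simp add: Yq_def)
          show "E (y i) (y j) = \<mu> i * b (y i) (y j)" if "i \<in> {1..q}" "j \<in> {1..q}" for i j
            unfolding E_def using that q by (intro diag) auto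
          show "\<mu> i \<le> \<mu> q" if "i \<in> {1..q}" for i
            using mono q that by (auto simp: mono_on_def)
        qed (auto intro: E)
        then have "\<epsilon> * b u u \<le> - D \<nu> u u"
          by (simp add: D_def \<nu>_def algebra_simps)
        moreover have "\<epsilon> * (d / \<kappa> * (norm u)\<^sup>2) \<le> \<epsilon> * b u u"
          using \<epsilon> by (intro mult_left_mono bY Yq that) auto
        ultimately show ?thesis by simp
      qed
      show "\<forall>\<^sub>F h in at_right 0. \<forall>v. \<bar>- R \<nu> h v\<bar> \<le> \<sigma> * h * (norm v)\<^sup>2" if "0 < \<sigma>" for \<sigma>
        using R[OF that] by simp
    qed
    define I where "I = {1..<k} <+> {1..q}"
    have fI: "case_sum e y ` I = e ` {1..<k} \<union> y ` {1..q}"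
      by (auto simp: I_def image_Un image_image Plus_def)
    have on: "orthonormal I (case_sum e y)"
      unfolding orthonormal_def
    proof (intro ballI)
      fix i i' assume "i \<in> I" "i' \<in> I"
      moreover have "b (e i) (y j) = 0" "b (y j) (e i) = 0" if "i \<in> {1..<k}" "j \<in> {1..q}" for i j
      proof -
        have "y j \<in> span (y ` {1..m})"
          using that q by (intro span_base imageI) auto
        then show "b (y j) (e i) = 0"
          using orth_low that by simp
        then show "b (e i) (y j) = 0"
          by (simp add: sym)
      qed
      ultimately show "b (case_sum e y i) (case_sum e y i') = of_bool (i = i')"
        using q by (auto simp: I_def orthonormalD[OF e] orthonormalD[OF y])
    qed
    have indep: "independent (e ` {1..<k} \<union> y ` {1..q})"
      using orthonormal_independent[OF on] by (simp add: fI)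
    have card: "card (e ` {1..<k} \<union> y ` {1..q}) = j"
      using card_image[OF orthonormal_inj_on[OF on]] k q by (simp add: fI) (simp add: I_def card_Plus j_def)
    from ev pair show ?thesis
    proof eventually_elim
      case (elim h)
      show ?case
      proof (rule spectral_pair.ev_le_if_subspace[OF elim(2) indep card j])
        fix v assume "v \<in> span (e ` {1..<k} \<union> y ` {1..q})"
        then obtain w u where "v = w + u" "w \<in> W" "u \<in> Yq"
          unfolding span_Un W_def Yq_def by blast
        then have "0 \<le> - S v v + h * - D \<nu> v v + - R \<nu> h v"
          using elim(1) by blast
        then show "ah h v v \<le> (\<kappa> + h * (\<mu> q + \<epsilon>)) * bh h v v"
          by (simp add: R_def Q_def \<nu>_def)
      qed
    qed
  qed
  show ?thesis
    unfolding j_def[symmetric]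
  proof (rule tendstoI)
    fix \<epsilon> :: real assume "0 < \<epsilon>"
    then have "0 < \<epsilon> / 2" by simp
    note lower[OF this] upper[OF this]
    moreover have "\<forall>\<^sub>F h in at_right (0::real). 0 < h"
      by (rule eventually_at_right_less)
    ultimately show "\<forall>\<^sub>F h in at_right 0. dist ((nth_eigenvalue UNIV (ah h) (bh h) j - \<kappa>) / h) (\<mu> q) < \<epsilon>"
    proof eventually_elim
      case (elim h)
      define x where "x = (nth_eigenvalue UNIV (ah h) (bh h) j - \<kappa>) / h"
      have "\<mu> q - \<epsilon> / 2 \<le> x" "x \<le> \<mu> q + \<epsilon> / 2"
        using elim by (simp_all add: x_def field_simps)
      then show ?case
        using \<open>0 < \<epsilon>\<close> by (simp add: x_def[symmetric] dist_real_def abs_if)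
    qed
  qed
qed

text \<open>On an eigenspace, \<open>a\<close> is a multiple of \<open>b\<close>. Adding a large multiple of \<open>a\<close> to \<open>E\<close> therefore makes the
  form coercive on the whole space while shifting its eigenvalues on \<open>Y\<close> by a constant, and the
  minimization of the Rayleigh quotient on \<open>Y\<close> diagonalizes \<open>E\<close>.\<close>

lemma diagonalization_on_eigenspace:
  fixes E :: "'v \<Rightarrow> 'v \<Rightarrow> real"
  assumes E: "bounded_bilinear E" "\<And>u v. E u v = E v u"
    and Y: "Y = eigenspace UNIV a b \<kappa>" "Y = span F" and F: "independent F" "finite F" "card F = m"
  obtains y :: "nat \<Rightarrow> 'v" and \<mu> :: "nat \<Rightarrow> real" where
    "orthonormal {1..m} y" "Y = span (y ` {1..m})" "mono_on {1..m} \<mu>"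
    "\<And>j v. j \<in> {1..m} \<Longrightarrow> v \<in> Y \<Longrightarrow> E (y j) v = \<mu> j * b (y j) v"
    "\<And>j. j \<in> {1..m} \<Longrightarrow> nth_eigenvalue Y E b j = \<mu> j"
proof -
  interpret E: bounded_bilinear E by (rule E)
  obtain K where K: "0 < K" "\<And>u v. \<bar>E u v\<bar> \<le> norm u * norm v * K"
    using E.pos_bounded unfolding real_norm_def by blast
  \<comment> \<open>\<open>c * a\<close> is at least \<open>(K + d) * (norm u)\<^sup>2\<close>, which beats \<open>E\<close> and leaves \<open>d\<close>.\<close>
  define c where "c = (K + d) / d"
  define a1 where "a1 u v = E u v - (- c) * a u v" for u v
  have c: "0 \<le> c" using K(1) d_pos by (simp add: c_def)
  interpret E_pair: compact_form_pair b a1 d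
  proof (intro compact_form_pair.intro compact_form_pair_axioms.intro inner_form_axioms)
    show "\<exists>r. strict_mono (r :: nat \<Rightarrow> nat) \<and>
      (\<forall>e>0. \<exists>N. \<forall>i\<ge>N. \<forall>j\<ge>N. b (x (r i) - x (r j)) (x (r i) - x (r j)) < e)"
      if "bounded (range x)" for x :: "nat \<Rightarrow> 'v"
      by (rule compact[OF that])
    show "bounded_bilinear a1"
      unfolding a1_def by (rule bounded_bilinear_diff_scaled[OF E(1) bounded_a])
    show "a1 u v = a1 v u" for u v
      by (simp add: a1_def E(2)[of u v] sym_a[of u v])
    show "d * (norm u)\<^sup>2 \<le> a1 u u" for u
    proof -
      have "c * (d * (norm u)\<^sup>2) \<le> c * a u u"
        using c by (intro mult_left_mono coercive) auto
      moreover have "c * (d * (norm u)\<^sup>2) = K * (norm u)\<^sup>2 + d * (norm u)\<^sup>2"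
        using d_pos by (simp add: c_def field_simps)
      ultimately show ?thesis
        using K(2)[of u u] by (simp add: a1_def power2_eq_square algebra_simps abs_le_iff)
    qed
  qed (rule d_pos)
  have subY: "subspace Y"
    unfolding Y(2) by (rule subspace_span)
  have "Y = (\<Inter>v. {u. a u v - \<kappa> * b u v = 0})"
    by (auto simp: Y(1) eigenspace_def)
  also have "closed \<dots>"
    by (intro closed_INT ballI closed_Collect_eq continuous_intros
        a.continuous_on b.continuous_on)
  finally have closedY: "closed Y" .
  have large: "\<exists>G \<subseteq> Y. independent G \<and> card G = j" if "j \<in> {1..m}" for j
  proof -
    have "j \<le> card F" using that F(3) by simp
    then obtain G where "G \<subseteq> F" "card G = j"
      by (metis obtain_subset_with_card_n)
    then show ?thesis
      using independent_mono[OF F(1)] span_superset[of F] Y(2) by blast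
  qed
  obtain y :: "nat \<Rightarrow> 'v" and l where yY: "\<And>j. j \<in> {1..m} \<Longrightarrow> y j \<in> Y" and on: "orthonormal {1..m} y"
    and eig: "\<And>j v. j \<in> {1..m} \<Longrightarrow> v \<in> Y \<Longrightarrow> a1 (y j) v = l j * b (y j) v"
    and mono: "mono_on {1..m} l"
  proof (rule E_pair.eigenbasis_exists[OF subY closedY disjI2[OF refl]])
    fix y :: "nat \<Rightarrow> 'v" and l assume "\<And>j. j \<in> {1..m} \<Longrightarrow> y j \<in> Y" "orthonormal {1..m} y"
      "\<And>j v. j \<in> {1..m} \<Longrightarrow> v \<in> Y \<Longrightarrow> a1 (y j) v = l j * b (y j) v" "mono_on {1..m} l"
    then show thesis by (rule that)
  qed (rule large)
  define \<mu> where "\<mu> j = l j - c * \<kappa>" for j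
  have eigE: "E (y j) v = \<mu> j * b (y j) v" if "j \<in> {1..m}" "v \<in> Y" for j v
    using eig[OF that] yY[OF that(1)] Y(1)
    by (simp add: a1_def \<mu>_def eigenspace_def algebra_simps)
  have span: "Y = span (y ` {1..m})"
  proof
    show "span (y ` {1..m}) \<subseteq> Y"
      using yY by (intro span_minimal subY) auto
    show "Y \<subseteq> span (y ` {1..m})"
    proof
      fix u assume u: "u \<in> Y"
      show "u \<in> span (y ` {1..m})"
      proof (rule ccontr)
        assume "u \<notin> span (y ` {1..m})"
        moreover from this have new: "u \<notin> y ` {1..m}"
          by (auto intro: span_base)
        ultimately have "independent (insert u (y ` {1..m}))"
          using orthonormal_independent[OF on] by (simp add: independent_insert)
        moreover have "insert u (y ` {1..m}) \<subseteq> span F"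
          using u yY Y(2) by auto
        ultimately have "card (insert u (y ` {1..m})) \<le> card F"
          using independent_span_bound[OF F(2), of "insert u (y ` {1..m})"] by blast
        then show False
          using new F(3) card_image[OF orthonormal_inj_on[OF on]] by simp
      qed
    qed
  qed
  have mono\<mu>: "mono_on {1..m} \<mu>"
    using mono by (auto simp: mono_on_def \<mu>_def)
  have "nth_eigenvalue Y E b j = \<mu> j" if "j \<in> {1..m}" for j
  proof (rule nth_eigenvalue_eq[OF disjI2[OF refl] subY E yY on eigE _ _ mono\<mu> that])
    fix \<nu> u assume "u \<in> eigenspace Y E b \<nu>" and orth: "\<And>j. j \<in> {1..m} \<Longrightarrow> b u (y j) = 0"
    then have "u \<in> span (y ` {1..m})"
      using span by (simp add: eigenspace_def)
    then have "b u u = 0"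
      by (rule orthogonal_to_span[rotated]) (use orth in auto)
    then show "u = 0" by (simp add: eq_0_iff)
  qed simp_all
  with on span mono\<mu> eigE show ?thesis
    using that[of y \<mu>] by blast
qed

end

text \<open>Symmetry of the derivative forms is what makes \<open>E\<close> diagonalizable; they inherit it from the difference
  quotients.\<close>

lemma derivative_form_symmetric:
  fixes f :: "real \<Rightarrow> 'v::real_normed_vector \<Rightarrow> 'v \<Rightarrow> real"
  assumes sym: "\<forall>\<^sub>F h in at 0. \<forall>u v. f h u v = f h v u" "\<And>u v. f0 u v = f0 v u"
    and deriv: "\<And>\<sigma>. 0 < \<sigma> \<Longrightarrow>
      \<forall>\<^sub>F h in at 0. \<forall>u v. \<bar>f h u v - f0 u v - h * f' u v\<bar> \<le> \<sigma> * \<bar>h\<bar> * (norm u * norm v)"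
  shows "f' u v = f' v u"
proof (rule ccontr)
  assume neq: "f' u v \<noteq> f' v u"
  define n where "n = norm u * norm v + 1"
  have n: "0 < n" by (simp add: n_def add_nonneg_pos)
  define \<sigma> where "\<sigma> = \<bar>f' u v - f' v u\<bar> / (2 * n)"
  have \<sigma>: "0 < \<sigma>" using neq n by (simp add: \<sigma>_def)
  have "\<forall>\<^sub>F h in at (0::real). h \<noteq> 0"
    by (rule eventually_neq_at_within)
  with sym(1) deriv[OF \<sigma>] have "\<forall>\<^sub>F h in at (0::real). False"
  proof eventually_elim
    case (elim h)
    define r where "r u v = f h u v - f0 u v - h * f' u v" for u v
    have "\<bar>r u v\<bar> \<le> \<sigma> * \<bar>h\<bar> * (norm u * norm v)" "\<bar>r v u\<bar> \<le> \<sigma> * \<bar>h\<bar> * (norm v * norm u)"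
      using elim(2) by (auto simp: r_def)
    moreover have "\<bar>h\<bar> * \<bar>f' u v - f' v u\<bar> = \<bar>r v u - r u v\<bar>"
      using elim(1) sym(2)[of u v] by (simp add: r_def abs_mult[symmetric] algebra_simps)
    ultimately have "\<bar>h\<bar> * \<bar>f' u v - f' v u\<bar> \<le> 2 * (\<sigma> * \<bar>h\<bar> * (norm u * norm v))"
      by (simp add: mult.commute[of "norm v"])
    also have "\<dots> < 2 * (\<sigma> * \<bar>h\<bar> * n)"
      using \<sigma> elim(3) by (simp add: n_def)
    also have "\<dots> = \<bar>h\<bar> * \<bar>f' u v - f' v u\<bar>"
      using n by (simp add: \<sigma>_def)
    finally show False by simp
  qed
  then show False by (simp add: eventually_False trivial_limit_at)
qed

context spectral_pair
begin

text \<open>For the left derivative, \<open>eigenvalue_right_derivative\<close> is applied to the family \<open>h \<mapsto> (ah (- h), bh (- h))\<close>,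
  whose derivative forms are \<open>- a'\<close> and \<open>- b'\<close>. Its ordered basis is \<open>z i = y (m + 1 - i)\<close> with the
  values \<open>- \<mu> (m + 1 - i)\<close>; the sign of the values cancels against the sign of \<open>h\<close> in the quotient.\<close>

theorem eigenvalue_cluster_derivatives:
  fixes ah bh :: "real \<Rightarrow> 'v \<Rightarrow> 'v \<Rightarrow> real" and a' b' :: "'v \<Rightarrow> 'v \<Rightarrow> real" and k m j :: nat
  defines "Y \<equiv> eigenspace UNIV a b (ev k)"
  defines "mu \<equiv> nth_eigenvalue Y (\<lambda>u v. a' u v - ev k * b' u v) b"
  assumes pair: "\<forall>\<^sub>F h in at 0. spectral_pair (bh h) (ah h) d"
    and a': "bounded_bilinear a'" and b': "bounded_bilinear b'"
    and da: "\<And>\<sigma>. 0 < \<sigma> \<Longrightarrow>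
      \<forall>\<^sub>F h in at 0. \<forall>u v. \<bar>ah h u v - a u v - h * a' u v\<bar> \<le> \<sigma> * \<bar>h\<bar> * (norm u * norm v)"
    and db: "\<And>\<sigma>. 0 < \<sigma> \<Longrightarrow>
      \<forall>\<^sub>F h in at 0. \<forall>u v. \<bar>bh h u v - b u v - h * b' u v\<bar> \<le> \<sigma> * \<bar>h\<bar> * (norm u * norm v)"
    and k: "1 \<le> k" and gap_left: "k = 1 \<or> ev (k - 1) < ev k"
    and cluster: "\<And>i. i \<in> {k..k + m - 1} \<Longrightarrow> ev i = ev k"
    and gap_right: "ev (k + m - 1) < ev (k + m)"
    and j: "j \<in> {k..k + m - 1}"
  shows "((\<lambda>h. (nth_eigenvalue UNIV (ah h) (bh h) j - ev j) / h) \<longlongrightarrow> mu (j - k + 1)) (at_right 0)"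
    and "((\<lambda>h. (nth_eigenvalue UNIV (ah h) (bh h) j - ev j) / h) \<longlongrightarrow> mu (k + m - j)) (at_left 0)"
proof -
  define \<kappa> where "\<kappa> = ev k"
  have \<kappa>: "0 < \<kappa>" unfolding \<kappa>_def by (rule ev_pos[OF k])
  define E where "E u v = a' u v - \<kappa> * b' u v" for u v
  have E: "bounded_bilinear E"
    unfolding E_def by (rule bounded_bilinear_diff_scaled[OF a' b'])
  have sym_ah: "\<forall>\<^sub>F h in at 0. \<forall>u v. ah h u v = ah h v u"
    using pair
    by eventually_elim (meson compact_form_pair.sym_a spectral_pair.axioms(1))
  have sym_bh: "\<forall>\<^sub>F h in at 0. \<forall>u v. bh h u v = bh h v u"
    using pair
    by eventually_elim (meson inner_form.sym compact_form_pair.axioms(1) spectral_pair.axioms(1))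
  have E_sym: "E u v = E v u" for u v
    using derivative_form_symmetric[OF sym_ah sym_a da, of u v]
      derivative_form_symmetric[OF sym_bh sym db, of u v] by (simp add: E_def)
  have m: "1 \<le> m" using j k by auto
  have cl: "ev i = \<kappa> \<longleftrightarrow> i \<in> {k..k + m - 1}" if "1 \<le> i" for i
  proof
    assume "ev i = \<kappa>"
    then have "\<not> i < k"
      using gap_left ev_mono[of i "k - 1"] that by (fastforce simp: \<kappa>_def)
    moreover have "\<not> k + m \<le> i"
      using gap_right ev_mono[of "k + m" i] cluster[of "k + m - 1"] k m \<open>ev i = \<kappa>\<close>
      by (fastforce simp: \<kappa>_def)
    ultimately show "i \<in> {k..k + m - 1}" by auto
  next
    assume "i \<in> {k..k + m - 1}"
    from cluster[OF this] show "ev i = \<kappa>" by (simp only: \<kappa>_def)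
  qed
  obtain e where basis: "spectral_basis e" by (rule spectral_basis_exists)
  let ?F = "e ` {k..k + m - 1}"
  have "i \<in> {i \<in> {1..}. ev i = \<kappa>} \<longleftrightarrow> i \<in> {k..k + m - 1}" for i
    using cl[of i] k by (cases "1 \<le> i") auto
  then have "{i \<in> {1..}. ev i = \<kappa>} = {k..k + m - 1}"
    by blast
  then have Y: "Y = span ?F"
    using spectral_basisD(4)[OF basis, of \<kappa>] by (simp add: Y_def \<kappa>_def)
  have on: "orthonormal {k..k + m - 1} e"
    using k by (intro orthonormal_subset[OF spectral_basisD(1)[OF basis]]) auto
  have card: "card ?F = m"
    using card_image[OF orthonormal_inj_on[OF on]] m by simp
  obtain y \<mu> where y: "orthonormal {1..m} y" "Y = span (y ` {1..m})" "mono_on {1..m} \<mu>"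
    and eigE: "\<And>j v. j \<in> {1..m} \<Longrightarrow> v \<in> Y \<Longrightarrow> E (y j) v = \<mu> j * b (y j) v"
    and nth: "\<And>j. j \<in> {1..m} \<Longrightarrow> nth_eigenvalue Y E b j = \<mu> j"
  proof (rule diagonalization_on_eigenspace[OF E E_sym _ Y orthonormal_independent[OF on] _ card])
    show "Y = eigenspace UNIV a b \<kappa>"
      by (simp only: Y_def \<kappa>_def)
    fix y :: "nat \<Rightarrow> 'v" and \<mu> assume "orthonormal {1..m} y" "Y = span (y ` {1..m})" "mono_on {1..m} \<mu>"
      "\<And>j v. j \<in> {1..m} \<Longrightarrow> v \<in> Y \<Longrightarrow> E (y j) v = \<mu> j * b (y j) v"
      "\<And>j. j \<in> {1..m} \<Longrightarrow> nth_eigenvalue Y E b j = \<mu> j"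
    then show thesis by (rule that)
  qed simp
  have mu: "mu i = \<mu> i" if "i \<in> {1..m}" for i
    using nth[OF that] by (simp add: mu_def E_def[abs_def] \<kappa>_def)
  have cl': "ev i = \<kappa>" if "i \<in> {k..k + m - 1}" for i
    using cluster[OF that] by (simp only: \<kappa>_def)
  have gl: "k = 1 \<or> ev (k - 1) < \<kappa>"
    using gap_left by (simp only: \<kappa>_def)
  have gr: "\<kappa> < ev (k + m)"
    using gap_right cl'[of "k + m - 1"] m by simp
  have Y\<kappa>: "eigenspace UNIV a b \<kappa> = span (y ` {1..m})"
    using y(2) by (simp add: Y_def \<kappa>_def)
  have diag: "E (y i) (y j) = \<mu> i * b (y i) (y j)" if "i \<in> {1..m}" "j \<in> {1..m}" for i j
    using that y(2) by (intro eigE) (auto intro: span_base)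
  define q where "q = j - k + 1"
  have q: "q \<in> {1..m}" "j = k + q - 1" "m + 1 - q \<in> {1..m}" "k + m - j = m + 1 - q"
    using j m by (auto simp: q_def)
  have evj: "ev j = \<kappa>" by (rule cl'[OF j])
  have "((\<lambda>h. (nth_eigenvalue UNIV (ah h) (bh h) (k + q - 1) - \<kappa>) / h) \<longlongrightarrow> \<mu> q) (at_right 0)"
  proof (rule eigenvalue_right_derivative[OF _ a' b' _ _ k gl cl' gr \<kappa> y(1) Y\<kappa> _ y(3) q(1)])
    show "\<forall>\<^sub>F h in at_right 0. spectral_pair (bh h) (ah h) d"
      using pair by (simp add: eventually_at_split)
    fix \<sigma> :: real assume "0 < \<sigma>"
    have "\<forall>\<^sub>F h in at_right 0. \<forall>u v. \<bar>ah h u v - a u v - h * a' u v\<bar> \<le> \<sigma> * \<bar>h\<bar> * (norm u * norm v)"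
      using da[OF \<open>0 < \<sigma>\<close>] by (simp add: eventually_at_split)
    moreover have "\<forall>\<^sub>F h in at_right (0::real). 0 < h"
      by (rule eventually_at_right_less)
    ultimately show "\<forall>\<^sub>F h in at_right 0. \<forall>v. \<bar>ah h v v - a v v - h * a' v v\<bar> \<le> \<sigma> * h * (norm v)\<^sup>2"
      by eventually_elim (simp add: power2_eq_square)
    have "\<forall>\<^sub>F h in at_right 0. \<forall>u v. \<bar>bh h u v - b u v - h * b' u v\<bar> \<le> \<sigma> * \<bar>h\<bar> * (norm u * norm v)"
      using db[OF \<open>0 < \<sigma>\<close>] by (simp add: eventually_at_split)
    moreover have "\<forall>\<^sub>F h in at_right (0::real). 0 < h"
      by (rule eventually_at_right_less)
    ultimately show "\<forall>\<^sub>F h in at_right 0. \<forall>v. \<bar>bh h v v - b v v - h * b' v v\<bar> \<le> \<sigma> * h * (norm v)\<^sup>2"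
      by eventually_elim (simp add: power2_eq_square)
  qed (assumption, rule diag[unfolded E_def])
  then show "((\<lambda>h. (nth_eigenvalue UNIV (ah h) (bh h) j - ev j) / h) \<longlongrightarrow> mu (j - k + 1)) (at_right 0)"
    unfolding q(2)[symmetric] evj q_def[symmetric] mu[OF q(1)] .
  define z where "z i = y (m + 1 - i)" for i
  have reflect: "m + 1 - i \<in> {1..m}" if "i \<in> {1..m}" for i
    using that by auto
  have z: "orthonormal {1..m} z"
    using reflect unfolding orthonormal_def z_def by (auto simp: orthonormalD[OF y(1)])
  have "(\<lambda>i. m + 1 - i) ` {1..m} = {1..m}"
  proof (intro subset_antisym subsetI)
    fix i assume "i \<in> {1..m}"
    then show "i \<in> (\<lambda>i. m + 1 - i) ` {1..m}"
      by (intro image_eqI[of _ _ "m + 1 - i"]) auto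
  qed auto
  then have "z ` {1..m} = y ` {1..m}"
    unfolding z_def by (metis image_image)
  then have Yz: "eigenspace UNIV a b \<kappa> = span (z ` {1..m})"
    using Y\<kappa> by simp
  have monoz: "mono_on {1..m} (\<lambda>i. - \<mu> (m + 1 - i))"
  proof (rule mono_onI)
    fix i j assume "i \<in> {1..m}" "j \<in> {1..m}" "i \<le> j"
    then have "\<mu> (m + 1 - j) \<le> \<mu> (m + 1 - i)"
      by (intro mono_onD[OF y(3) reflect reflect]) auto
    then show "- \<mu> (m + 1 - i) \<le> - \<mu> (m + 1 - j)" by simp
  qed
  have "((\<lambda>h. (nth_eigenvalue UNIV (ah (- h)) (bh (- h)) (k + q - 1) - \<kappa>) / h)
    \<longlongrightarrow> - \<mu> (m + 1 - q)) (at_right 0)"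
  proof (rule eigenvalue_right_derivative[OF _ bounded_bilinear_uminus[OF a'] bounded_bilinear_uminus[OF b']
        _ _ k gl cl' gr \<kappa> z Yz _ monoz q(1)])
    show "\<forall>\<^sub>F h in at_right 0. spectral_pair (bh (- h)) (ah (- h)) d"
      using pair by (simp add: eventually_at_split eventually_at_left_to_right)
    fix \<sigma> :: real assume "0 < \<sigma>"
    have "\<forall>\<^sub>F h in at_right 0. \<forall>u v.
        \<bar>ah (- h) u v - a u v - (- h) * a' u v\<bar> \<le> \<sigma> * \<bar>- h\<bar> * (norm u * norm v)"
      using da[OF \<open>0 < \<sigma>\<close>] by (simp add: eventually_at_split eventually_at_left_to_right)
    moreover have "\<forall>\<^sub>F h in at_right (0::real). 0 < h"
      by (rule eventually_at_right_less)
    ultimately show "\<forall>\<^sub>F h in at_right 0. \<forall>v.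
        \<bar>ah (- h) v v - a v v - h * - a' v v\<bar> \<le> \<sigma> * h * (norm v)\<^sup>2"
      by eventually_elim (simp add: power2_eq_square)
    have "\<forall>\<^sub>F h in at_right 0. \<forall>u v.
        \<bar>bh (- h) u v - b u v - (- h) * b' u v\<bar> \<le> \<sigma> * \<bar>- h\<bar> * (norm u * norm v)"
      using db[OF \<open>0 < \<sigma>\<close>] by (simp add: eventually_at_split eventually_at_left_to_right)
    moreover have "\<forall>\<^sub>F h in at_right (0::real). 0 < h"
      by (rule eventually_at_right_less)
    ultimately show "\<forall>\<^sub>F h in at_right 0. \<forall>v.
        \<bar>bh (- h) v v - b v v - h * - b' v v\<bar> \<le> \<sigma> * h * (norm v)\<^sup>2"
      by eventually_elim (simp add: power2_eq_square)
  next
    fix i j assume "i \<in> {1..m}" "j \<in> {1..m}"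
    then show "- a' (z i) (z j) - \<kappa> * - b' (z i) (z j) = - \<mu> (m + 1 - i) * b (z i) (z j)"
      using diag[OF reflect reflect, of i j] by (simp add: z_def E_def)
  qed
  from tendsto_minus[OF this]
  have "((\<lambda>h. (nth_eigenvalue UNIV (ah (- h)) (bh (- h)) j - ev j) / - h) \<longlongrightarrow> \<mu> (m + 1 - q)) (at_right 0)"
    unfolding q(2)[symmetric] evj by simp
  then show "((\<lambda>h. (nth_eigenvalue UNIV (ah h) (bh h) j - ev j) / h) \<longlongrightarrow> mu (k + m - j)) (at_left 0)"
    unfolding q(4) mu[OF q(3)] by (simp add: filterlim_at_left_to_right)
qed

end

section \<open>Forms on a compactly embedded space\<close>

lemma bounded_bilinear_of_bound:
  fixes f :: "'a::real_normed_vector \<Rightarrow> 'b::real_normed_vector \<Rightarrow> real"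
  assumes "bilinear f" "\<And>u v. \<bar>f u v\<bar> \<le> C * norm u * norm v"
  shows "bounded_bilinear f"
proof
  show "\<exists>K. \<forall>u v. norm (f u v) \<le> norm u * norm v * K"
    using assms(2) by (intro exI[of _ C]) (simp add: mult_ac)
qed (simp_all add: bilinear_ladd[OF assms(1)] bilinear_radd[OF assms(1)]
    bilinear_lmul[OF assms(1)] bilinear_rmul[OF assms(1)])

text \<open>Boundedness is essential: on an unbounded set of values the supremum would be an arbitrary number.\<close>

lemma abs_le_form_sup:
  fixes f :: "'a::real_normed_vector \<Rightarrow> 'a \<Rightarrow> real"
  assumes "bounded_bilinear f"
  shows "\<bar>f u v\<bar> \<le> form_sup f * (norm u * norm v)"
proof -
  interpret f: bounded_bilinear f by (rule assms)
  obtain K where K: "0 < K" "\<And>u v. \<bar>f u v\<bar> \<le> norm u * norm v * K"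
    using f.pos_bounded unfolding real_norm_def by blast
  have bdd: "bdd_above ((\<lambda>(u, v). \<bar>f u v\<bar>) ` (cball 0 1 \<times> cball 0 1))"
  proof (rule bdd_aboveI)
    fix r assume "r \<in> (\<lambda>(u, v). \<bar>f u v\<bar>) ` (cball 0 1 \<times> cball 0 1)"
    then obtain u v where uv: "norm u \<le> 1" "norm v \<le> 1" "r = \<bar>f u v\<bar>" by auto
    have "norm u * norm v * K \<le> 1 * 1 * K"
      using uv K(1) by (intro mult_mono) auto
    then show "r \<le> K" using K(2)[of u v] uv(3) by simp
  qed
  show ?thesis
  proof (cases "u = 0 \<or> v = 0")
    case True
    then show ?thesis by (auto simp: f.zero_left f.zero_right)
  next
    case False
    define u' v' where "u' = (1 / norm u) *\<^sub>R u" and "v' = (1 / norm v) *\<^sub>R v"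
    have "(u', v') \<in> cball 0 1 \<times> cball 0 1"
      using False by (simp add: u'_def v'_def)
    then have "\<bar>f u' v'\<bar> \<le> form_sup f"
      unfolding form_sup_def using cSUP_upper[OF _ bdd, of "(u', v')"] by simp
    moreover have "\<bar>f u' v'\<bar> = \<bar>f u v\<bar> / (norm u * norm v)"
      by (simp add: u'_def v'_def f.scaleR_left f.scaleR_right abs_mult)
    ultimately show ?thesis
      using False by (simp add: field_simps)
  qed
qed

lemma eventually_remainder_le:
  fixes f :: "real \<Rightarrow> 'a::real_normed_vector \<Rightarrow> 'a \<Rightarrow> real"
  assumes bb: "\<forall>\<^sub>F h in at 0. bounded_bilinear (f h)"
    and lim: "((\<lambda>h. 1 / h * form_sup (f h)) \<longlongrightarrow> 0) (at 0)" and \<sigma>: "0 < \<sigma>"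
  shows "\<forall>\<^sub>F h in at 0. \<forall>u v. \<bar>f h u v\<bar> \<le> \<sigma> * \<bar>h\<bar> * (norm u * norm v)"
proof -
  have "\<forall>\<^sub>F h in at (0::real). h \<noteq> 0"
    by (rule eventually_neq_at_within)
  with bb tendstoD[OF lim \<sigma>] show ?thesis
  proof eventually_elim
    case (elim h)
    have "\<bar>form_sup (f h)\<bar> < \<sigma> * \<bar>h\<bar>"
      using elim(2,3) by (simp add: abs_mult field_simps)
    then have "form_sup (f h) \<le> \<sigma> * \<bar>h\<bar>" by simp
    then show ?case
      using abs_le_form_sup[OF elim(1)]
      by (meson mult_right_mono mult_nonneg_nonneg norm_ge_zero order_trans)
  qed
qed

text \<open>A bounded sequence has a subsequence whose image under the embedding converges; its differences then
  tend to zero in the form pulled back from the larger space.\<close>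

lemma spectral_pair_of_compact_embedding:
  fixes \<iota> :: "'v::{real_normed_vector,complete_space} \<Rightarrow> 'x::real_normed_vector"
  assumes emb: "compact_embedding \<iota>"
    and inf_dim: "\<nexists>F :: 'v set. finite F \<and> span F = UNIV" and \<delta>: "0 < \<delta>" and C: "0 < C"
    and A: "bilinear A" "\<And>u v. A u v = A v u" "\<And>u v. \<bar>A u v\<bar> \<le> C * norm u * norm v"
      "\<And>u. \<delta> * (norm u)\<^sup>2 \<le> A u u"
    and B: "bilinear B" "\<And>u v. B u v = B v u" "\<And>u v. \<bar>B u v\<bar> \<le> C * norm u * norm v"
      "\<And>u. \<delta> * (norm u)\<^sup>2 \<le> B u u"
  shows "spectral_pair (\<lambda>u v. B (\<iota> u) (\<iota> v)) A \<delta>"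
proof -
  have \<iota>: "bounded_linear \<iota>" "inj \<iota>" and cpt: "\<And>S. bounded S \<Longrightarrow> compact (closure (\<iota> ` S))"
    using emb by (auto simp: compact_embedding_def)
  show ?thesis
  proof (intro spectral_pair.intro compact_form_pair.intro inner_form.intro
      compact_form_pair_axioms.intro spectral_pair_axioms.intro)
    show "bounded_bilinear (\<lambda>u v. B (\<iota> u) (\<iota> v))"
      using bounded_bilinear.comp[OF bounded_bilinear_of_bound[OF B(1,3)] \<iota>(1) \<iota>(1)] .
    show "bounded_bilinear A"
      by (rule bounded_bilinear_of_bound[OF A(1,3)])
    show "0 < B (\<iota> u) (\<iota> u)" if "u \<noteq> 0" for u
    proof -
      have "\<iota> u \<noteq> 0"
        using that \<iota>(2) linear_0[OF bounded_linear.linear[OF \<iota>(1)]] by (metis injD)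
      then have "0 < \<delta> * (norm (\<iota> u))\<^sup>2" using \<delta> by simp
      then show ?thesis using B(4)[of "\<iota> u"] by simp
    qed
    show "\<exists>r. strict_mono (r :: nat \<Rightarrow> nat) \<and> (\<forall>e>0. \<exists>N. \<forall>i\<ge>N. \<forall>j\<ge>N.
        B (\<iota> (x (r i) - x (r j))) (\<iota> (x (r i) - x (r j))) < e)"
      if "bounded (range x)" for x :: "nat \<Rightarrow> 'v"
    proof -
      have "seq_compact (closure (\<iota> ` range x))"
        using cpt[OF that] by (simp add: compact_eq_seq_compact_metric)
      moreover have "\<forall>n. \<iota> (x n) \<in> closure (\<iota> ` range x)"
        by (intro allI subsetD[OF closure_subset]) simp
      ultimately obtain l r where r: "strict_mono (r :: nat \<Rightarrow> nat)"
        and "((\<lambda>n. \<iota> (x n)) \<circ> r) \<longlonglongrightarrow> l"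
        by (rule seq_compactE)
      then have lim: "(\<lambda>n. \<iota> (x (r n))) \<longlonglongrightarrow> l" by (simp add: o_def)
      have "\<exists>N. \<forall>i\<ge>N. \<forall>j\<ge>N. B (\<iota> (x (r i) - x (r j))) (\<iota> (x (r i) - x (r j))) < e" if e: "0 < e" for e
      proof -
        have "0 < sqrt (e / C)" using e C by simp
        from CauchyD[OF LIMSEQ_imp_Cauchy[OF lim] this] obtain N where
          N: "\<And>i j. i \<ge> N \<Longrightarrow> j \<ge> N \<Longrightarrow> norm (\<iota> (x (r i)) - \<iota> (x (r j))) < sqrt (e / C)" by blast
        show ?thesis
        proof (intro exI allI impI)
          fix i j assume ij: "i \<ge> N" "j \<ge> N"
          define w where "w = \<iota> (x (r i) - x (r j))"
          have "norm w < sqrt (e / C)"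
            using N[OF ij] by (simp add: w_def linear_diff[OF bounded_linear.linear[OF \<iota>(1)]])
          then have "(norm w)\<^sup>2 < (sqrt (e / C))\<^sup>2"
            by (intro power_strict_mono) auto
          then have "C * (norm w)\<^sup>2 < e"
            using e C by (simp add: field_simps)
          then show "B (\<iota> (x (r i) - x (r j))) (\<iota> (x (r i) - x (r j))) < e"
            using B(3)[of w w] by (simp add: w_def power2_eq_square mult.assoc abs_le_iff)
        qed
      qed
      with r show ?thesis by blast
    qed
  qed (use A B \<delta> inf_dim in auto)
qed

theorem theorem12:
  fixes \<iota> :: "'v::{real_inner,complete_space} \<Rightarrow> 'x::{real_inner,complete_space}"
    and A :: "real \<Rightarrow> 'v \<Rightarrow> 'v \<Rightarrow> real" and B :: "real \<Rightarrow> 'x \<Rightarrow> 'x \<Rightarrow> real"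
    and A' :: "'v \<Rightarrow> 'v \<Rightarrow> real" and B' :: "'x \<Rightarrow> 'x \<Rightarrow> real"
    and lam :: "real \<Rightarrow> nat \<Rightarrow> real" and mu :: "nat \<Rightarrow> real"
    and Y :: "'v set"
    and \<epsilon>0 C \<delta> t lamk :: real and k m :: nat
  defines "lam \<equiv> \<lambda>s. nth_eigenvalue UNIV (A s) (\<lambda>u v. B s (\<iota> u) (\<iota> v))"
  defines "lamk \<equiv> lam t k"
  defines "Y \<equiv> eigenspace UNIV (A t) (\<lambda>u v. B t (\<iota> u) (\<iota> v)) lamk"
  defines "mu \<equiv> nth_eigenvalue Y (\<lambda>u v. A' u v - lamk * B' (\<iota> u) (\<iota> v))
                   (\<lambda>u v. B t (\<iota> u) (\<iota> v))"
  assumes emb: "compact_embedding \<iota>"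
    and inf_dim: "\<nexists>F :: 'v set. finite F \<and> span F = UNIV"
    and pos: "0 < \<epsilon>0" "0 < C" "0 < \<delta>"
    and A_bilinear: "\<And>s. s \<in> {-\<epsilon>0<..<\<epsilon>0} \<Longrightarrow> bilinear (A s)"
    and A_sym: "\<And>s u v. s \<in> {-\<epsilon>0<..<\<epsilon>0} \<Longrightarrow> A s u v = A s v u"
    and A_bound: "\<And>s u v. s \<in> {-\<epsilon>0<..<\<epsilon>0} \<Longrightarrow> \<bar>A s u v\<bar> \<le> C * norm u * norm v"
    and A_coercive: "\<And>s u. s \<in> {-\<epsilon>0<..<\<epsilon>0} \<Longrightarrow> A s u u \<ge> \<delta> * (norm u)\<^sup>2"
    and B_bilinear: "\<And>s. s \<in> {-\<epsilon>0<..<\<epsilon>0} \<Longrightarrow> bilinear (B s)"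
    and B_sym: "\<And>s u v. s \<in> {-\<epsilon>0<..<\<epsilon>0} \<Longrightarrow> B s u v = B s v u"
    and B_bound: "\<And>s u v. s \<in> {-\<epsilon>0<..<\<epsilon>0} \<Longrightarrow> \<bar>B s u v\<bar> \<le> C * norm u * norm v"
    and B_coercive: "\<And>s u. s \<in> {-\<epsilon>0<..<\<epsilon>0} \<Longrightarrow> B s u u \<ge> \<delta> * (norm u)\<^sup>2"
    and t: "t \<in> {-\<epsilon>0<..<\<epsilon>0}"
    and A'_bilinear: "bilinear A'"
    and A'_bound: "\<And>u v. \<bar>A' u v\<bar> \<le> C * norm u * norm v"
    and B'_bilinear: "bilinear B'"
    and B'_bound: "\<And>u v. \<bar>B' u v\<bar> \<le> C * norm u * norm v"
    and A_deriv: "((\<lambda>h. 1 / h * form_sup (\<lambda>u v. A (t + h) u v - A t u v - h * A' u v)) \<longlongrightarrow> 0) (at 0)"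
    and B_deriv: "((\<lambda>h. 1 / h * form_sup (\<lambda>u v. B (t + h) u v - B t u v - h * B' u v)) \<longlongrightarrow> 0) (at 0)"
    and km: "1 \<le> k" "1 \<le> m"
    \<comment> \<open>for \<open>k = 1\<close> the left gap is void, as \<open>lam t 0 = -\<infinity>\<close> by convention\<close>
    and gap_left: "k = 1 \<or> lam t (k - 1) < lam t k"
    and cluster: "\<And>j. j \<in> {k..k + m - 1} \<Longrightarrow> lam t j = lam t k"
    and gap_right: "lam t (k + m - 1) < lam t (k + m)"
  shows "\<exists>Dp Dm :: nat \<Rightarrow> real.
    (\<forall>j \<in> {k..k + m - 1}.
        ((\<lambda>h. 1 / h * (lam (t + h) j - lam t j)) \<longlongrightarrow> Dp j) (at_right 0) \<and>
        ((\<lambda>h. 1 / h * (lam (t + h) j - lam t j)) \<longlongrightarrow> Dm j) (at_left 0) \<and>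
        Dp j = mu (j - k + 1) \<and> Dm j = mu (k + m - j)) \<and>
    (\<forall>j \<in> {k..k + m - 1}. Dp j = Dm (2 * k + m - 1 - j))"
proof -
  define b where "b = (\<lambda>s u v. B s (\<iota> u) (\<iota> v))"
  define b' where "b' = (\<lambda>u v. B' (\<iota> u) (\<iota> v))"
  have lam: "lam s = nth_eigenvalue UNIV (A s) (b s)" for s
    by (simp add: lam_def b_def)
  have sp: "spectral_pair (b s) (A s) \<delta>" if "s \<in> {-\<epsilon>0<..<\<epsilon>0}" for s
    unfolding b_def
    by (rule spectral_pair_of_compact_embedding[OF emb inf_dim pos(3,2)
        A_bilinear[OF that] A_sym[OF that] A_bound[OF that] A_coercive[OF that]
        B_bilinear[OF that] B_sym[OF that] B_bound[OF that] B_coercive[OF that]])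
  interpret spectral_pair "b t" "A t" \<delta>
    by (rule sp[OF t])
  have \<iota>: "bounded_linear \<iota>"
    using emb by (simp add: compact_embedding_def)
  have bb_A: "bounded_bilinear (A s)" and bb_B: "bounded_bilinear (B s)" if "s \<in> {-\<epsilon>0<..<\<epsilon>0}" for s
    by (rule bounded_bilinear_of_bound[OF A_bilinear[OF that] A_bound[OF that]]
        bounded_bilinear_of_bound[OF B_bilinear[OF that] B_bound[OF that]])+
  have bb_A': "bounded_bilinear A'" and bb_B': "bounded_bilinear B'"
    by (rule bounded_bilinear_of_bound[OF A'_bilinear A'_bound]
        bounded_bilinear_of_bound[OF B'_bilinear B'_bound])+
  have bb_b': "bounded_bilinear b'"
    unfolding b'_def by (rule bounded_bilinear.comp[OF bb_B' \<iota> \<iota>])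
  have "((\<lambda>h. t + h) \<longlongrightarrow> t) (at 0)"
    using tendsto_add[OF tendsto_const tendsto_ident_at, of t 0 UNIV] by simp
  then have near: "\<forall>\<^sub>F h in at 0. t + h \<in> {-\<epsilon>0<..<\<epsilon>0}"
    using t by (intro topological_tendstoD) auto
  have remainder: "bounded_bilinear (\<lambda>u v. f u v - g u v - h * f' u v)"
    if "bounded_bilinear f" "bounded_bilinear g" "bounded_bilinear f'"
    for f g f' :: "'c::real_normed_vector \<Rightarrow> 'c \<Rightarrow> real" and h
    using bounded_bilinear_diff_scaled[OF bounded_bilinear_diff_scaled[OF that(1,2), of 1] that(3)] by simp
  have da: "\<forall>\<^sub>F h in at 0. \<forall>u v.
      \<bar>A (t + h) u v - A t u v - h * A' u v\<bar> \<le> \<sigma> * \<bar>h\<bar> * (norm u * norm v)" if "0 < \<sigma>" for \<sigma>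
    by (rule eventually_remainder_le[OF eventually_mono[OF near] A_deriv that])
      (intro remainder bb_A bb_A' t)
  have dB: "\<forall>\<^sub>F h in at 0. \<forall>u v.
      \<bar>B (t + h) u v - B t u v - h * B' u v\<bar> \<le> \<sigma> * \<bar>h\<bar> * (norm u * norm v)" if "0 < \<sigma>" for \<sigma>
    by (rule eventually_remainder_le[OF eventually_mono[OF near] B_deriv that])
      (intro remainder bb_B bb_B' t)
  obtain K where K: "0 < K" "\<And>u. norm (\<iota> u) \<le> norm u * K"
    using bounded_linear.pos_bounded[OF \<iota>] by blast
  have db: "\<forall>\<^sub>F h in at 0. \<forall>u v.
      \<bar>b (t + h) u v - b t u v - h * b' u v\<bar> \<le> \<sigma> * \<bar>h\<bar> * (norm u * norm v)" if "0 < \<sigma>" for \<sigma>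
  proof -
    have \<sigma>: "0 < \<sigma> / (K * K)" using that K by simp
    from dB[OF \<sigma>] show ?thesis
    proof eventually_elim
      case (elim h)
      show ?case
      proof (intro allI)
        fix u v
        have "\<bar>b (t + h) u v - b t u v - h * b' u v\<bar> \<le> \<sigma> / (K * K) * \<bar>h\<bar> * (norm (\<iota> u) * norm (\<iota> v))"
          using elim by (simp add: b_def b'_def)
        also have "\<dots> \<le> \<sigma> / (K * K) * \<bar>h\<bar> * ((norm u * K) * (norm v * K))"
          using K by (intro mult_left_mono mult_mono mult_nonneg_nonneg less_imp_le[OF \<sigma>]) auto
        also have "\<dots> = \<sigma> * \<bar>h\<bar> * (norm u * norm v)"
          using K by (simp add: field_simps)
        finally show "\<bar>b (t + h) u v - b t u v - h * b' u v\<bar> \<le> \<sigma> * \<bar>h\<bar> * (norm u * norm v)" .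
      qed
    qed
  qed
  have mu: "mu = nth_eigenvalue (eigenspace UNIV (A t) (b t) (lam t k))
      (\<lambda>u v. A' u v - lam t k * b' u v) (b t)"
    by (simp add: mu_def Y_def lamk_def b_def b'_def)
  note derivatives = eigenvalue_cluster_derivatives[of "\<lambda>h. b (t + h)" "\<lambda>h. A (t + h)" A' b' k m,
      folded lam, OF eventually_mono[OF near sp] bb_A' bb_b' da db km(1) gap_left cluster gap_right,
      folded mu]
  show ?thesis
  proof (rule exI[of _ "\<lambda>j. mu (j - k + 1)"], rule exI[of _ "\<lambda>j. mu (k + m - j)"],
      intro conjI ballI)
    fix j assume j: "j \<in> {k..k + m - 1}"
    show "((\<lambda>h. 1 / h * (lam (t + h) j - lam t j)) \<longlongrightarrow> mu (j - k + 1)) (at_right 0)"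
      using derivatives(1)[OF _ _ _ _ j] by simp
    show "((\<lambda>h. 1 / h * (lam (t + h) j - lam t j)) \<longlongrightarrow> mu (k + m - j)) (at_left 0)"
      using derivatives(2)[OF _ _ _ _ j] by simp
    have "k + m - (2 * k + m - 1 - j) = j - k + 1"
      using j km by auto
    then show "mu (j - k + 1) = mu (k + m - (2 * k + m - 1 - j))"
      by simp
  qed simp_all
qed

end
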